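(* Let $C$ be a while-program and suppose that the compilation judgement $\{\},\epsilon\vdash C\hookrightarrow P,\langle w,t\rangle,l,\Phi$ is derivable (starting from the empty register record $\{\}$ and the empty label $\epsilon$). Then the RISC program $P$ is strongly secure.
   Context: **RISC machine.** $\mathbb W$ is the set of machine words, $\mathit{Reg}$ a set of register names, $\mathit{Lab}$ a set of labels. A register bank is $\mathsf R:\mathit{Reg}\to\mathbb W$, a data memory is $\mathcal M:\mathbb W\to\mathbb W$. A RISC program (code memory) $P$ is a finite list of instructions, positions numbered from $0$, each of the form $B$ or $l:B$ ($l\in\mathit{Lab}$), no label occurring twice, with $B::=\mathsf{load}\ r\ k\mid\mathsf{store}\ k\ r\mid\mathsf{jmp}\ l\mid\mathsf{jz}\ l\ r\mid\mathsf{nop}\mid\mathsf{movek}\ r\ k\mid\mathsf{mover}\ r\ r'\mid\mathsf{op}\ r\ r'\mid\mathsf{out}\ ch\ r$, where $k\in\mathbb W$, $ch\in\{\mathit{low},\mathit{high}\}$, and $\mathsf{op}$ is a binary operator on $\mathbb W$. $\mathrm{res}_P(l)$ is the position of label $l$ in $P$ (undefined if $l$ does not label an instruction of $P$). States are $\langle P,pc,\mathsf R,\mathcal M\rangle$ with $pc\in\mathbb W$ (programs are short enough that positions and their successors are in $\mathbb W$). According to the instruction $P(pc)$, there is a single transition, which leaves $P$ unchanged, has label $\tau$ except for $\mathsf{out}$, and moves $pc$ to $pc+1$ unless stated otherwise: $\mathsf{load}\ r\ k$ sets $\mathsf R(r):=\mathcal M(k)$; $\mathsf{store}\ k\ r$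 sets $\mathcal M(k):=\mathsf R(r)$; $\mathsf{jmp}\ l$ sets $pc:=\mathrm{res}_P(l)$; $\mathsf{jz}\ l\ r$ sets $pc:=\mathrm{res}_P(l)$ if $\mathsf R(r)=0$ and otherwise only increments $pc$; $\mathsf{nop}$ does nothing; $\mathsf{movek}\ r\ k$ sets $\mathsf R(r):=k$; $\mathsf{mover}\ r\ r'$ sets $\mathsf R(r):=\mathsf R(r')$; $\mathsf{op}\ r\ r'$ sets $\mathsf R(r):=\mathsf R(r)\ \mathsf{op}\ \mathsf R(r')$; $\mathsf{out}\ ch\ r$ has label $ch!\mathsf R(r)$ and changes nothing else. There is no transition if $P(pc)$ is undefined or the required $\mathrm{res}_P(l)$ is undefined (the state is stuck). **Security levels.** $\mathit{Var}$ is the set of while-variables, $v2p:\mathit{Var}\to\mathbb W$ an injective map. $\mathrm{level}:\mathit{Var}\cup\mathit{Reg}\to\{L,H\}$ is given, with order $L\sqsubseteq H$; channels have $\mathrm{level}(\mathit{low})=L$, $\mathrm{level}(\mathit{high})=H$. $(\mathsf R,\mathcal M)=_{\mathsf L}(\mathsf R',\mathcal M')$ means $\mathsf R(r)=\mathsf R'(r)$ for all $r$ with $\mathrm{level}(r)=L$ and $\mathcal M(v2p(x))=\mathcal M'(v2p(x))$ for all $x$ with $\mathrm{level}(x)=L$ (all other registers and memory cells are regarded as high). $\mathrm{low}(\mathit{low}!k)=\mathit{low}!k$, and $\mathrm{low}(a)=\tau$ for every other action. **Strong security of a RISC program.** Let $\to_\infty$ be the RISC transition relation extended with $s\xrightarrow{\tau}_\infty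 s$ for stuck states $s$. A symmetric relation $\mathcal B$ on pairs (code memory, program counter) is a strong bisimulation if whenever $((P_1,pc_1),(P_2,pc_2))\in\mathcal B$, $(\mathsf R_1,\mathcal M_1)=_{\mathsf L}(\mathsf R_2,\mathcal M_2)$ and $\langle P_1,pc_1,\mathsf R_1,\mathcal M_1\rangle\xrightarrow{a}_\infty\langle P_1,pc_1',\mathsf R_1',\mathcal M_1'\rangle$, then $\langle P_2,pc_2,\mathsf R_2,\mathcal M_2\rangle\xrightarrow{b}_\infty\langle P_2,pc_2',\mathsf R_2',\mathcal M_2'\rangle$ with $\mathrm{low}(a)=\mathrm{low}(b)$, $(\mathsf R_1',\mathcal M_1')=_{\mathsf L}(\mathsf R_2',\mathcal M_2')$ and $((P_1,pc_1'),(P_2,pc_2'))\in\mathcal B$. $P$ is strongly secure if $((P,0),(P,0))\in\mathcal B$ for some strong bisimulation $\mathcal B$. **While-programs.** $C::=\mathsf{skip}\mid x:=E\mid\mathsf{if}\ E\ \mathsf{then}\ C_1\ \mathsf{else}\ C_2\mid\mathsf{out}\ ch\ E\mid C_1;C_2\mid\mathsf{while}\ x\ \mathsf{do}\ C$, with $E::=k\in\mathbb W\mid x\in\mathit{Var}\mid E_1\ \mathsf{op}\ E_2$. **Register records.** A register record $\Phi$ is a partial injective function $\mathit{Reg}\rightharpoonup\mathit{Var}$. $\Phi[r\not\to]$ removes any association of $r$. $\Phi[r\leftrightarrow x]$ removes any association of $r$ and any association of $x$, then associates $r$ with $x$. $\Phi\sqcap\Phi'$ is the set of associations common to both; $\Phi\sqsubseteq\Phi'$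 is inclusion of associations. **Code conventions.** $\epsilon$ is the empty label ($\epsilon:B$ is $B$). $\iota$ is the empty instruction: $[l:\iota]\mathbin{+\!\!+}[B,I_1,\dots]=[l:B,I_1,\dots]$, and an unlabelled $\iota$ may be erased. $l:P$ attaches $l$ to the first instruction of $P$. $\mathsf{nop}^m$ is $m$ consecutive $\mathsf{nop}$'s if $m>0$ and $\iota$ otherwise. $\mathbin{+\!\!+}$ is concatenation, required to yield a program without duplicate labels. "Fresh" labels do not occur elsewhere. **Annotations.** Write effects: $\mathsf{Wr}\,H\sqsubseteq\mathsf{Wr}\,L$, with join $\sqcup$. Timings: $\mathsf{Trm}\,0\sqsubseteq\mathsf{Trm}\,1\sqsubseteq\dots\sqsubseteq\mathsf{Trm}\,L\sqsubseteq\mathsf{Trm}\,H$. $t_1\veebar t_2=\mathsf{Trm}\,L$ if $t_1,t_2\sqsubseteq\mathsf{Trm}\,L$, else $\mathsf{Trm}\,H$. $t_1\uplus t_2=\mathsf{Trm}\,(n_1+n_2)$ if $t_i=\mathsf{Trm}\,n_i$ with $n_i\in\mathbb N$ for $i=1,2$, else $t_1\veebar t_2$. $\mathrm{write}(H)=\mathsf{Wr}\,H$, $\mathrm{write}(L)=\mathsf{Wr}\,L$, $\mathrm{term}(L)=\mathsf{Trm}\,L$, $\mathrm{term}(H)=\mathsf{Trm}\,H$. **Expression rules** $\Phi,A,l\Vdash E\hookrightarrow P,\langle\lambda,n\rangle,r,\Phi'$ ($A\subseteq\mathit{Reg}$): - (K) if $r\notin A$: $\Phi,A,l\Vdash k\hookrightarrow[l:\mathsf{movek}\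 r\ k],\langle\mathrm{level}(r),1\rangle,r,\Phi[r\not\to]$. - (V-cached) if $\Phi(r)=x$: $\Phi,A,l\Vdash x\hookrightarrow[l:\iota],\langle\mathrm{level}(r),0\rangle,r,\Phi$. - (V-uncached) if $r\notin A$ and $\mathrm{level}(x)\sqsubseteq\mathrm{level}(r)$: $\Phi,A,l\Vdash x\hookrightarrow[l:\mathsf{load}\ r\ v2p(x)],\langle\mathrm{level}(r),1\rangle,r,\Phi[r\leftrightarrow x]$. - (C) if $\Phi,A,l\Vdash E_1\hookrightarrow P_1,\langle\lambda,n_1\rangle,r,\Phi_1$ and $\Phi_1,A\cup\{r\},\epsilon\Vdash E_2\hookrightarrow P_2,\langle\lambda,n_2\rangle,r',\Phi_2$, then $\Phi,A,l\Vdash E_1\ \mathsf{op}\ E_2\hookrightarrow P_1\mathbin{+\!\!+}P_2\mathbin{+\!\!+}[\mathsf{op}\ r\ r'],\langle\lambda,n_1+n_2+1\rangle,r,\Phi_2[r\not\to]$. **Command rules** $\Phi,l\vdash C\hookrightarrow P,\langle w,t\rangle,l',\Phi'$: - (skip) $\Phi,l\vdash\mathsf{skip}\hookrightarrow[l:\mathsf{nop}],\langle\mathsf{Wr}\,H,\mathsf{Trm}\,1\rangle,\epsilon,\Phi$. - (:=) if $\Phi,\emptyset,l\Vdash E\hookrightarrow P,\langle\mathrm{level}(x),n\rangle,r,\Phi'$, then $\Phi,l\vdash x:=E\hookrightarrow P\mathbin{+\!\!+}[\mathsf{store}\ v2p(x)\ r],tp,\epsilon,\Phi'[r\leftrightarrow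 x]$, where $tp=\langle\mathsf{Wr}\,H,\mathsf{Trm}\,(n+1)\rangle$ if $\mathrm{level}(x)=H$ and $tp=\langle\mathsf{Wr}\,L,\mathsf{Trm}\,L\rangle$ otherwise. - (out) if $\Phi,\emptyset,l\Vdash E\hookrightarrow P,\langle\mathrm{level}(ch),n\rangle,r,\Phi'$, then $\Phi,l\vdash\mathsf{out}\ ch\ E\hookrightarrow P\mathbin{+\!\!+}[\mathsf{out}\ ch\ r],tp,\epsilon,\Phi'$, where $tp=\langle\mathsf{Wr}\,H,\mathsf{Trm}\,(n+1)\rangle$ if $\mathrm{level}(ch)=H$ and $\langle\mathsf{Wr}\,L,\mathsf{Trm}\,L\rangle$ otherwise. - (if-any) if $\Phi,\emptyset,l\Vdash E\hookrightarrow P_0,\langle\lambda,n_0\rangle,r,\Phi_1$; $\Phi_1,\epsilon\vdash C_i\hookrightarrow P_i,\langle w_i,t_i\rangle,l_i,\Phi_{i+1}$ and $w_i\sqsubseteq\mathrm{write}(\lambda)$ for $i=1,2$; $br,ex$ fresh; then $\Phi,l\vdash\mathsf{if}\ E\ \mathsf{then}\ C_1\ \mathsf{else}\ C_2\hookrightarrow P_0\mathbin{+\!\!+}[\mathsf{jz}\ br\ r]\mathbin{+\!\!+}P_1\mathbin{+\!\!+}[l_1:\mathsf{jmp}\ ex]\mathbin{+\!\!+}br:P_2\mathbin{+\!\!+}[l_2:\mathsf{nop}],\ \langle\mathrm{write}(\lambda),\mathrm{term}(\lambda)\veebar t_1\veebar t_2\rangle,ex,\Phi_2\sqcap\Phi_3$.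 - (if-H) if $\Phi,\emptyset,l\Vdash E\hookrightarrow P_0,\langle H,n_0\rangle,r,\Phi_1$; $\Phi_1,\epsilon\vdash C_i\hookrightarrow P_i,\langle\mathsf{Wr}\,H,\mathsf{Trm}\,n_i\rangle,l_i,\Phi_{i+1}$ ($n_i\in\mathbb N$) for $i=1,2$; $m=n_0+\max(n_1,n_2)+2$; $br,ex$ fresh; then $\Phi,l\vdash\mathsf{if}\ E\ \mathsf{then}\ C_1\ \mathsf{else}\ C_2\hookrightarrow P_0\mathbin{+\!\!+}[\mathsf{jz}\ br\ r]\mathbin{+\!\!+}P_1\mathbin{+\!\!+}l_1:\mathsf{nop}^{n_2-n_1}\mathbin{+\!\!+}[\mathsf{jmp}\ ex]\mathbin{+\!\!+}br:P_2\mathbin{+\!\!+}l_2:\mathsf{nop}^{n_1-n_2}\mathbin{+\!\!+}[\mathsf{nop}],\ \langle\mathsf{Wr}\,H,\mathsf{Trm}\,m\rangle,ex,\Phi_2\sqcap\Phi_3$. - (seq) if $\Phi,l\vdash C_1\hookrightarrow P_1,\langle w_1,t_1\rangle,l_1,\Phi_1$; $\Phi_1,l_1\vdash C_2\hookrightarrow P_2,\langle w_2,t_2\rangle,l_2,\Phi_2$; and $t_1=\mathsf{Trm}\,H$ implies $w_2=\mathsf{Wr}\,H$; then $\Phi,l\vdash C_1;C_2\hookrightarrow P_1\mathbin{+\!\!+}P_2,\langle w_1\sqcup w_2,t_1\uplus t_2\rangle,l_2,\Phi_2$. - (while) if $\lambda=\mathrm{level}(x)=\mathrm{level}(r)$;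 $\Phi_B\sqsubseteq\Phi[r\leftrightarrow x]$; $\Phi_B\sqsubseteq\Phi_E[r\leftrightarrow x]$; $\Phi_B,\epsilon\vdash C\hookrightarrow P,\langle w,t\rangle,l',\Phi_E$; $w\sqsubseteq\mathrm{write}(\lambda)$; $t=\mathsf{Trm}\,H$ implies $\mathrm{write}(\lambda)=\mathsf{Wr}\,H$; $P_i=[\mathsf{load}\ r\ v2p(x),\ \mathsf{store}\ v2p(x)\ r]$; $lp,ex$ fresh; then $\Phi,l\vdash\mathsf{while}\ x\ \mathsf{do}\ C\hookrightarrow l:P_i\mathbin{+\!\!+}[lp:\mathsf{jz}\ ex\ r]\mathbin{+\!\!+}P\mathbin{+\!\!+}l':P_i\mathbin{+\!\!+}[\mathsf{jmp}\ lp],\ \langle\mathrm{write}(\lambda),\mathrm{term}(\lambda)\veebar t\rangle,ex,\Phi_B$. *)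

theory Defs
  imports Main
begin

section \<open>The RISC machine\<close>

datatype level = L | H

datatype chan = Low | High

fun chan_level :: "chan \<Rightarrow> level" where
  "chan_level Low = L"
| "chan_level High = H"

text \<open>
  Machine words are an arbitrary type \<^typ>\<open>'w\<close> of class \<^class>\<open>semiring_1\<close> (for instance a type of
  fixed-width words); only \<open>0\<close>, the
  numbering \<open>of_nat\<close> of positions and its successor \<open>pc + 1\<close> are ever used.  The binary
  operator of an \<open>Op\<close> instruction, and of an operator expression below, is an arbitrary function.
\<close>

datatype (dead 'w, 'reg, targets: 'lab) instr =
    Load 'reg 'w
  | Store 'w 'reg
  | Jmp 'lab
  | Jz 'lab 'reg
  | Nop
  | Movek 'reg 'w
  | Mover 'reg 'reg
  | Op "'w \<Rightarrow> 'w \<Rightarrow> 'w" 'reg 'reg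
  | Out chan 'reg

type_synonym ('w, 'reg, 'lab) program = "('lab option \<times> ('w, 'reg, 'lab) instr) list"

text \<open>
  The choices made by \<open>LEAST\<close> below are unique as soon as \<open>of_nat\<close> is injective on the positions of
  the program (\<open>fetch\<close>) and no label occurs twice (\<open>resolve\<close>).
\<close>

definition fetch ::
  "('w::semiring_1, 'reg, 'lab) program \<Rightarrow> 'w \<Rightarrow> ('w, 'reg, 'lab) instr option" where
  "fetch P pc =
     (if \<exists>i<length P. of_nat i = pc then Some (snd (P ! (LEAST i. of_nat i = pc))) else None)"

definition resolve :: "('w::semiring_1, 'reg, 'lab) program \<Rightarrow> 'lab \<Rightarrow> 'w option" where
  "resolve P l =
     (if \<exists>i<length P. fst (P ! i) = Some l
      then Some (of_nat (LEAST i. i < length P \<and> fst (P ! i) = Some l)) else None)"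

text \<open>
  Positions \<open>0, \<dots>, length P - 1\<close> and their successors are (distinct) machine words.
\<close>

definition fits :: "('w::semiring_1, 'reg, 'lab) program \<Rightarrow> bool" where
  "fits P \<longleftrightarrow> inj_on (of_nat :: nat \<Rightarrow> 'w) {..length P}"

datatype 'w action = Tau | Output chan 'w

fun low :: "'w action \<Rightarrow> 'w action" where
  "low (Output Low k) = Output Low k"
| "low (Output High k) = Tau"
| "low Tau = Tau"

type_synonym ('w, 'reg, 'lab) state =
  "('w, 'reg, 'lab) program \<times> 'w \<times> ('reg \<Rightarrow> 'w) \<times> ('w \<Rightarrow> 'w)"

inductive step ::
  "('w::semiring_1, 'reg, 'lab) state \<Rightarrow> 'w action \<Rightarrow> ('w, 'reg, 'lab) state \<Rightarrow> bool" where
  load: "fetch P pc = Some (Load r k) \<Longrightarrow>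
    step (P, pc, R, M) Tau (P, pc + 1, R(r := M k), M)"
| store: "fetch P pc = Some (Store k r) \<Longrightarrow>
    step (P, pc, R, M) Tau (P, pc + 1, R, M(k := R r))"
| jmp: "fetch P pc = Some (Jmp l) \<Longrightarrow> resolve P l = Some pc' \<Longrightarrow>
    step (P, pc, R, M) Tau (P, pc', R, M)"
| jz_taken: "fetch P pc = Some (Jz l r) \<Longrightarrow> R r = 0 \<Longrightarrow> resolve P l = Some pc' \<Longrightarrow>
    step (P, pc, R, M) Tau (P, pc', R, M)"
| jz_not_taken: "fetch P pc = Some (Jz l r) \<Longrightarrow> R r \<noteq> 0 \<Longrightarrow>
    step (P, pc, R, M) Tau (P, pc + 1, R, M)"
| nop: "fetch P pc = Some Nop \<Longrightarrow>
    step (P, pc, R, M) Tau (P, pc + 1, R, M)"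
| movek: "fetch P pc = Some (Movek r k) \<Longrightarrow>
    step (P, pc, R, M) Tau (P, pc + 1, R(r := k), M)"
| mover: "fetch P pc = Some (Mover r r') \<Longrightarrow>
    step (P, pc, R, M) Tau (P, pc + 1, R(r := R r'), M)"
| oper: "fetch P pc = Some (Op f r r') \<Longrightarrow>
    step (P, pc, R, M) Tau (P, pc + 1, R(r := f (R r) (R r')), M)"
| out: "fetch P pc = Some (Out ch r) \<Longrightarrow>
    step (P, pc, R, M) (Output ch (R r)) (P, pc + 1, R, M)"

definition stuck :: "('w::semiring_1, 'reg, 'lab) state \<Rightarrow> bool" where
  "stuck s \<longleftrightarrow> (\<nexists>a s'. step s a s')"

definition step_inf ::
  "('w::semiring_1, 'reg, 'lab) state \<Rightarrow> 'w action \<Rightarrow> ('w, 'reg, 'lab) state \<Rightarrow> bool" where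
  "step_inf s a s' \<longleftrightarrow> step s a s' \<or> (stuck s \<and> a = Tau \<and> s' = s)"


section \<open>Strong security\<close>

text \<open>
  The level map on variables and registers is given by two functions: \<open>vl\<close> on variables and \<open>rl\<close> on
  registers.
\<close>

definition low_eq ::
  "('var \<Rightarrow> 'w) \<Rightarrow> ('var \<Rightarrow> level) \<Rightarrow> ('reg \<Rightarrow> level) \<Rightarrow>
   ('reg \<Rightarrow> 'w) \<times> ('w \<Rightarrow> 'w) \<Rightarrow> ('reg \<Rightarrow> 'w) \<times> ('w \<Rightarrow> 'w) \<Rightarrow> bool" where
  "low_eq v2p vl rl = (\<lambda>(R, M) (R', M').
     (\<forall>r. rl r = L \<longrightarrow> R r = R' r) \<and> (\<forall>x. vl x = L \<longrightarrow> M (v2p x) = M' (v2p x)))"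

definition strong_bisimulation ::
  "('var \<Rightarrow> 'w) \<Rightarrow> ('var \<Rightarrow> level) \<Rightarrow> ('reg \<Rightarrow> level) \<Rightarrow>
   (('w::semiring_1, 'reg, 'lab) program \<times> 'w) rel \<Rightarrow> bool" where
  "strong_bisimulation v2p vl rl B \<longleftrightarrow> sym B \<and>
     (\<forall>P\<^sub>1 pc\<^sub>1 P\<^sub>2 pc\<^sub>2 R\<^sub>1 M\<^sub>1 R\<^sub>2 M\<^sub>2 a pc\<^sub>1' R\<^sub>1' M\<^sub>1'.
        ((P\<^sub>1, pc\<^sub>1), (P\<^sub>2, pc\<^sub>2)) \<in> B \<longrightarrow>
        low_eq v2p vl rl (R\<^sub>1, M\<^sub>1) (R\<^sub>2, M\<^sub>2) \<longrightarrow>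
        step_inf (P\<^sub>1, pc\<^sub>1, R\<^sub>1, M\<^sub>1) a (P\<^sub>1, pc\<^sub>1', R\<^sub>1', M\<^sub>1') \<longrightarrow>
        (\<exists>b pc\<^sub>2' R\<^sub>2' M\<^sub>2'.
           step_inf (P\<^sub>2, pc\<^sub>2, R\<^sub>2, M\<^sub>2) b (P\<^sub>2, pc\<^sub>2', R\<^sub>2', M\<^sub>2') \<and>
           low a = low b \<and>
           low_eq v2p vl rl (R\<^sub>1', M\<^sub>1') (R\<^sub>2', M\<^sub>2') \<and>
           ((P\<^sub>1, pc\<^sub>1'), (P\<^sub>2, pc\<^sub>2')) \<in> B))"

definition strongly_secure ::
  "('var \<Rightarrow> 'w) \<Rightarrow> ('var \<Rightarrow> level) \<Rightarrow> ('reg \<Rightarrow> level) \<Rightarrow>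
   ('w::semiring_1, 'reg, 'lab) program \<Rightarrow> bool" where
  "strongly_secure v2p vl rl P \<longleftrightarrow>
     (\<exists>B. strong_bisimulation v2p vl rl B \<and> ((P, 0), (P, 0)) \<in> B)"


section \<open>While-programs\<close>

datatype ('w, 'var) expr =
    Const 'w
  | Var 'var
  | BinOp "('w, 'var) expr" "'w \<Rightarrow> 'w \<Rightarrow> 'w" "('w, 'var) expr"

datatype ('w, 'var) com =
    Skip
  | Assign 'var "('w, 'var) expr"
  | IfC "('w, 'var) expr" "('w, 'var) com" "('w, 'var) com"
  | OutC chan "('w, 'var) expr"
  | Seq "('w, 'var) com" "('w, 'var) com"
  | While 'var "('w, 'var) com"


section \<open>Register records\<close>

text \<open>
  Records are plain maps: the empty map is injective, and \<open>reg_forget\<close>, \<open>reg_assoc\<close>, \<open>rec_meet\<close> and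
  passing to a submap (\<open>\<subseteq>\<^sub>m\<close>) preserve injectivity, so every record in a derivation that starts from
  the empty record is injective.
\<close>

definition reg_forget :: "('reg \<rightharpoonup> 'var) \<Rightarrow> 'reg \<Rightarrow> ('reg \<rightharpoonup> 'var)" where
  "reg_forget \<Phi> r = \<Phi>(r := None)"

definition reg_assoc :: "('reg \<rightharpoonup> 'var) \<Rightarrow> 'reg \<Rightarrow> 'var \<Rightarrow> ('reg \<rightharpoonup> 'var)" where
  "reg_assoc \<Phi> r x = (\<lambda>r'. if \<Phi> r' = Some x then None else \<Phi> r')(r \<mapsto> x)"

definition rec_meet :: "('reg \<rightharpoonup> 'var) \<Rightarrow> ('reg \<rightharpoonup> 'var) \<Rightarrow> ('reg \<rightharpoonup> 'var)" where
  "rec_meet \<Phi> \<Phi>' = (\<lambda>r. if \<Phi> r = \<Phi>' r then \<Phi> r else None)"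


section \<open>Code with empty instructions\<close>

text \<open>
  Compilation produces code in which the body \<^const>\<open>None\<close> is the empty instruction, and the
  label \<^const>\<open>None\<close> is the empty label; \<open>@\<close> is concatenation.  The equations for the empty
  instruction are used by \<open>assemble\<close>, which turns code into a RISC program.
\<close>

type_synonym ('w, 'reg, 'lab) code = "('lab option \<times> ('w, 'reg, 'lab) instr option) list"

abbreviation ins :: "('w, 'reg, 'lab) instr \<Rightarrow> 'lab option \<times> ('w, 'reg, 'lab) instr option" where
  "ins I \<equiv> (None, Some I)"

text \<open>
  A label is only ever attached to nonempty code whose first instruction is unlabelled.
\<close>

fun attach :: "'lab option \<Rightarrow> ('lab option \<times> 'i) list \<Rightarrow> ('lab option \<times> 'i) list" where
  "attach None c = c"
| "attach (Some l) [] = []"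
| "attach (Some l) ((_, i) # c) = (Some l, i) # c"

fun assemble :: "('w, 'reg, 'lab) code \<Rightarrow> ('w, 'reg, 'lab) program" where
  "assemble [] = []"
| "assemble ((l, Some I) # c) = (l, I) # assemble c"
| "assemble ((l, None) # c) = attach l (assemble c)"

definition nops :: "nat \<Rightarrow> ('w, 'reg, 'lab) code" where
  "nops m = (if m > 0 then replicate m (ins Nop) else [(None, None)])"

definition distinct_labels :: "('w, 'reg, 'lab) code \<Rightarrow> bool" where
  "distinct_labels c \<longleftrightarrow> distinct (List.map_filter fst c)"

text \<open>All labels occurring in a piece of code, be it at an instruction or as a jump target.\<close>

definition labels :: "('w, 'reg, 'lab) code \<Rightarrow> 'lab set" where
  "labels c = (\<Union>(l, b)\<in>set c. set_option l \<union> \<Union> (targets ` set_option b))"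


section \<open>Annotations\<close>

fun level_le :: "level \<Rightarrow> level \<Rightarrow> bool" (infix \<open>\<sqsubseteq>\<^sub>l\<close> 50) where
  "l\<^sub>1 \<sqsubseteq>\<^sub>l l\<^sub>2 \<longleftrightarrow> l\<^sub>1 = L \<or> l\<^sub>2 = H"

datatype write_effect = WrH | WrL

fun write_le :: "write_effect \<Rightarrow> write_effect \<Rightarrow> bool" (infix \<open>\<sqsubseteq>\<^sub>w\<close> 50) where
  "w\<^sub>1 \<sqsubseteq>\<^sub>w w\<^sub>2 \<longleftrightarrow> w\<^sub>1 = WrH \<or> w\<^sub>2 = WrL"

fun write_join :: "write_effect \<Rightarrow> write_effect \<Rightarrow> write_effect" (infixl \<open>\<squnion>\<^sub>w\<close> 65) where
  "w\<^sub>1 \<squnion>\<^sub>w w\<^sub>2 = (if w\<^sub>1 \<sqsubseteq>\<^sub>w w\<^sub>2 then w\<^sub>2 else w\<^sub>1)"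

datatype timing = Trm nat | TrmL | TrmH

fun timing_le :: "timing \<Rightarrow> timing \<Rightarrow> bool" (infix \<open>\<sqsubseteq>\<^sub>t\<close> 50) where
  "Trm m \<sqsubseteq>\<^sub>t Trm n \<longleftrightarrow> m \<le> n"
| "Trm m \<sqsubseteq>\<^sub>t TrmL \<longleftrightarrow> True"
| "TrmL \<sqsubseteq>\<^sub>t Trm n \<longleftrightarrow> False"
| "TrmL \<sqsubseteq>\<^sub>t TrmL \<longleftrightarrow> True"
| "TrmH \<sqsubseteq>\<^sub>t t \<longleftrightarrow> t = TrmH"
| "t \<sqsubseteq>\<^sub>t TrmH \<longleftrightarrow> True"

definition timing_vee :: "timing \<Rightarrow> timing \<Rightarrow> timing" (infixl \<open>\<curlyvee>\<close> 65) where
  "t\<^sub>1 \<curlyvee> t\<^sub>2 = (if t\<^sub>1 \<sqsubseteq>\<^sub>t TrmL \<and> t\<^sub>2 \<sqsubseteq>\<^sub>t TrmL then TrmL else TrmH)"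

fun timing_plus :: "timing \<Rightarrow> timing \<Rightarrow> timing" (infixl \<open>\<uplus>\<^sub>t\<close> 65) where
  "Trm n\<^sub>1 \<uplus>\<^sub>t Trm n\<^sub>2 = Trm (n\<^sub>1 + n\<^sub>2)"
| "t\<^sub>1 \<uplus>\<^sub>t t\<^sub>2 = t\<^sub>1 \<curlyvee> t\<^sub>2"

fun write_of :: "level \<Rightarrow> write_effect" where
  "write_of H = WrH"
| "write_of L = WrL"

fun term_of_level :: "level \<Rightarrow> timing" where
  "term_of_level L = TrmL"
| "term_of_level H = TrmH"


section \<open>Compilation\<close>

inductive compile_expr ::
  "('var \<Rightarrow> 'w) \<Rightarrow> ('var \<Rightarrow> level) \<Rightarrow> ('reg \<Rightarrow> level) \<Rightarrow>
   ('reg \<rightharpoonup> 'var) \<Rightarrow> 'reg set \<Rightarrow> 'lab option \<Rightarrow> ('w, 'var) expr \<Rightarrow>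
   ('w, 'reg, 'lab) code \<Rightarrow> level \<times> nat \<Rightarrow> 'reg \<Rightarrow> ('reg \<rightharpoonup> 'var) \<Rightarrow> bool"
  for v2p :: "'var \<Rightarrow> 'w" and vl :: "'var \<Rightarrow> level" and rl :: "'reg \<Rightarrow> level" where
  K: "r \<notin> A \<Longrightarrow>
    compile_expr v2p vl rl \<Phi> A l (Const k) [(l, Some (Movek r k))] (rl r, 1) r (reg_forget \<Phi> r)"
| V_cached: "\<Phi> r = Some x \<Longrightarrow>
    compile_expr v2p vl rl \<Phi> A l (Var x) [(l, None)] (rl r, 0) r \<Phi>"
| V_uncached: "r \<notin> A \<Longrightarrow> vl x \<sqsubseteq>\<^sub>l rl r \<Longrightarrow>
    compile_expr v2p vl rl \<Phi> A l (Var x) [(l, Some (Load r (v2p x)))] (rl r, 1) r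
      (reg_assoc \<Phi> r x)"
| C: "compile_expr v2p vl rl \<Phi> A l E\<^sub>1 P\<^sub>1 (lam, n\<^sub>1) r \<Phi>\<^sub>1 \<Longrightarrow>
    compile_expr v2p vl rl \<Phi>\<^sub>1 (A \<union> {r}) None E\<^sub>2 P\<^sub>2 (lam, n\<^sub>2) r' \<Phi>\<^sub>2 \<Longrightarrow>
    P = P\<^sub>1 @ P\<^sub>2 @ [ins (Op f r r')] \<Longrightarrow> distinct_labels P \<Longrightarrow>
    compile_expr v2p vl rl \<Phi> A l (BinOp E\<^sub>1 f E\<^sub>2) P (lam, n\<^sub>1 + n\<^sub>2 + 1) r (reg_forget \<Phi>\<^sub>2 r)"

text \<open>
  Freshness is global: a label generated by one rule instance occurs nowhere else in the derivation,
  neither at an instruction nor as a jump target, except through the exit label of the judgement.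
  All labels of a judgement, incoming and exit label included, occur in its code, so
  this is expressed by disjointness of the label sets of the pieces combined by a rule
  (\<open>sorted_wrt disjnt\<close> is pairwise disjointness of a list of sets).  In \<open>seq\<close> the exit label of the
  first command is the only label the two pieces may share.  Absence of duplicate labels alone would
  not suffice, since the last exit label labels no instruction of the code.
\<close>

inductive compile ::
  "('var \<Rightarrow> 'w) \<Rightarrow> ('var \<Rightarrow> level) \<Rightarrow> ('reg \<Rightarrow> level) \<Rightarrow>
   ('reg \<rightharpoonup> 'var) \<Rightarrow> 'lab option \<Rightarrow> ('w, 'var) com \<Rightarrow>
   ('w, 'reg, 'lab) code \<Rightarrow> write_effect \<times> timing \<Rightarrow> 'lab option \<Rightarrow> ('reg \<rightharpoonup> 'var) \<Rightarrow> bool"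
  for v2p :: "'var \<Rightarrow> 'w" and vl :: "'var \<Rightarrow> level" and rl :: "'reg \<Rightarrow> level" where
  skip: "compile v2p vl rl \<Phi> l Skip [(l, Some Nop)] (WrH, Trm 1) None \<Phi>"
| assign: "compile_expr v2p vl rl \<Phi> {} l E P (vl x, n) r \<Phi>' \<Longrightarrow>
    Q = P @ [ins (Store (v2p x) r)] \<Longrightarrow> distinct_labels Q \<Longrightarrow>
    tp = (if vl x = H then (WrH, Trm (n + 1)) else (WrL, TrmL)) \<Longrightarrow>
    compile v2p vl rl \<Phi> l (Assign x E) Q tp None (reg_assoc \<Phi>' r x)"
| out: "compile_expr v2p vl rl \<Phi> {} l E P (chan_level ch, n) r \<Phi>' \<Longrightarrow>
    Q = P @ [ins (Out ch r)] \<Longrightarrow> distinct_labels Q \<Longrightarrow>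
    tp = (if chan_level ch = H then (WrH, Trm (n + 1)) else (WrL, TrmL)) \<Longrightarrow>
    compile v2p vl rl \<Phi> l (OutC ch E) Q tp None \<Phi>'"
| if_any: "compile_expr v2p vl rl \<Phi> {} l E P\<^sub>0 (lam, n\<^sub>0) r \<Phi>\<^sub>1 \<Longrightarrow>
    compile v2p vl rl \<Phi>\<^sub>1 None C\<^sub>1 P\<^sub>1 (w\<^sub>1, t\<^sub>1) l\<^sub>1 \<Phi>\<^sub>2 \<Longrightarrow> w\<^sub>1 \<sqsubseteq>\<^sub>w write_of lam \<Longrightarrow>
    compile v2p vl rl \<Phi>\<^sub>1 None C\<^sub>2 P\<^sub>2 (w\<^sub>2, t\<^sub>2) l\<^sub>2 \<Phi>\<^sub>3 \<Longrightarrow> w\<^sub>2 \<sqsubseteq>\<^sub>w write_of lam \<Longrightarrow>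
    sorted_wrt disjnt [labels P\<^sub>0, labels P\<^sub>1, labels P\<^sub>2, {br}, {ex}] \<Longrightarrow>
    Q = P\<^sub>0 @ [ins (Jz br r)] @ P\<^sub>1 @ [(l\<^sub>1, Some (Jmp ex))] @
        attach (Some br) P\<^sub>2 @ [(l\<^sub>2, Some Nop)] \<Longrightarrow>
    distinct_labels Q \<Longrightarrow>
    compile v2p vl rl \<Phi> l (IfC E C\<^sub>1 C\<^sub>2) Q (write_of lam, term_of_level lam \<curlyvee> t\<^sub>1 \<curlyvee> t\<^sub>2) (Some ex)
      (rec_meet \<Phi>\<^sub>2 \<Phi>\<^sub>3)"
| if_H: "compile_expr v2p vl rl \<Phi> {} l E P\<^sub>0 (H, n\<^sub>0) r \<Phi>\<^sub>1 \<Longrightarrow>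
    compile v2p vl rl \<Phi>\<^sub>1 None C\<^sub>1 P\<^sub>1 (WrH, Trm n\<^sub>1) l\<^sub>1 \<Phi>\<^sub>2 \<Longrightarrow>
    compile v2p vl rl \<Phi>\<^sub>1 None C\<^sub>2 P\<^sub>2 (WrH, Trm n\<^sub>2) l\<^sub>2 \<Phi>\<^sub>3 \<Longrightarrow>
    m = n\<^sub>0 + max n\<^sub>1 n\<^sub>2 + 2 \<Longrightarrow>
    sorted_wrt disjnt [labels P\<^sub>0, labels P\<^sub>1, labels P\<^sub>2, {br}, {ex}] \<Longrightarrow>
    Q = P\<^sub>0 @ [ins (Jz br r)] @ P\<^sub>1 @ attach l\<^sub>1 (nops (n\<^sub>2 - n\<^sub>1)) @ [ins (Jmp ex)] @
        attach (Some br) P\<^sub>2 @ attach l\<^sub>2 (nops (n\<^sub>1 - n\<^sub>2)) @ [ins Nop] \<Longrightarrow>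
    distinct_labels Q \<Longrightarrow>
    compile v2p vl rl \<Phi> l (IfC E C\<^sub>1 C\<^sub>2) Q (WrH, Trm m) (Some ex) (rec_meet \<Phi>\<^sub>2 \<Phi>\<^sub>3)"
| seq: "compile v2p vl rl \<Phi> l C\<^sub>1 P\<^sub>1 (w\<^sub>1, t\<^sub>1) l\<^sub>1 \<Phi>\<^sub>1 \<Longrightarrow>
    compile v2p vl rl \<Phi>\<^sub>1 l\<^sub>1 C\<^sub>2 P\<^sub>2 (w\<^sub>2, t\<^sub>2) l\<^sub>2 \<Phi>\<^sub>2 \<Longrightarrow>
    (t\<^sub>1 = TrmH \<longrightarrow> w\<^sub>2 = WrH) \<Longrightarrow>
    labels P\<^sub>1 \<inter> labels P\<^sub>2 \<subseteq> set_option l\<^sub>1 \<Longrightarrow>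
    distinct_labels (P\<^sub>1 @ P\<^sub>2) \<Longrightarrow>
    compile v2p vl rl \<Phi> l (Seq C\<^sub>1 C\<^sub>2) (P\<^sub>1 @ P\<^sub>2) (w\<^sub>1 \<squnion>\<^sub>w w\<^sub>2, t\<^sub>1 \<uplus>\<^sub>t t\<^sub>2) l\<^sub>2 \<Phi>\<^sub>2"
| while: "lam = vl x \<Longrightarrow> lam = rl r \<Longrightarrow>
    \<Phi>\<^sub>B \<subseteq>\<^sub>m reg_assoc \<Phi> r x \<Longrightarrow> \<Phi>\<^sub>B \<subseteq>\<^sub>m reg_assoc \<Phi>\<^sub>E r x \<Longrightarrow>
    compile v2p vl rl \<Phi>\<^sub>B None C P (w, t) l' \<Phi>\<^sub>E \<Longrightarrow>
    w \<sqsubseteq>\<^sub>w write_of lam \<Longrightarrow> (t = TrmH \<longrightarrow> write_of lam = WrH) \<Longrightarrow>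
    P\<^sub>i = [ins (Load r (v2p x)), ins (Store (v2p x) r)] \<Longrightarrow>
    sorted_wrt disjnt [set_option l, labels P, {lp}, {ex}] \<Longrightarrow>
    Q = attach l P\<^sub>i @ [(Some lp, Some (Jz ex r))] @ P @ attach l' P\<^sub>i @ [ins (Jmp lp)] \<Longrightarrow>
    distinct_labels Q \<Longrightarrow>
    compile v2p vl rl \<Phi> l (While x C) Q (write_of lam, term_of_level lam \<curlyvee> t) (Some ex) \<Phi>\<^sub>B"

end

theory Submission
  imports Defs
begin

text \<open>
  Every instruction produced by the compiler either is noninterfering or branches on a high
  register, so runs from low-equal states can only part at such a branch. Then either both arms
  take the same number of low-invisible steps to a common position (timing \<open>Trm n\<close>), or the
  annotation is \<open>TrmH\<close> and everything executed from there on is low-invisible. The bisimulation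
  therefore relates positions that both lie in the largest low-invisible region closed under
  execution, or that reach a common position in lockstep. The exit label of the whole program
  labels nothing, so the jumps to it are stuck; like the end of the program they belong to that
  region. Register records play no role: strong security quantifies over all low-equal
  register banks at every step.
\<close>

section \<open>Assembling code\<close>

lemma length_attach [simp]: "length (attach l c) = length c"
  by (cases "(l, c)" rule: attach.cases) auto

lemma length_assemble_append [simp]:
  "length (assemble (c @ d)) = length (assemble c) + length (assemble d)"
  by (induction c rule: assemble.induct) auto

lemma length_assemble_attach [simp]: "length (assemble (attach l c)) = length (assemble c)"
proof (cases "(l, c)" rule: attach.cases)
  case (3 x m b d)
  then show ?thesis by (cases b) auto
qed auto

definition instrs :: "('w, 'reg, 'lab) code \<Rightarrow> ('w, 'reg, 'lab) instr set" where
  "instrs c = {I. \<exists>l. (l, Some I) \<in> set c}"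

lemma instrs_simps [simp]:
  "instrs [] = {}"
  "instrs ((l, b) # c) = set_option b \<union> instrs c"
  "instrs (c @ d) = instrs c \<union> instrs d"
  by (auto simp: instrs_def)

lemma instrs_attach [simp]: "instrs (attach l c) = instrs c"
  by (cases "(l, c)" rule: attach.cases) auto

lemma instrs_nops: "instrs (nops n) \<subseteq> {Nop}"
  by (auto simp: nops_def instrs_def)

lemma length_assemble_nops [simp]: "length (assemble (nops n)) = n"
proof -
  have "length (assemble (replicate n (ins Nop))) = n"
    by (induction n) auto
  then show ?thesis by (auto simp: nops_def)
qed

text \<open>
  \<open>unclashed b c\<close> says that assembling \<open>c\<close> never overwrites a label, where \<open>b\<close> tells whether a label
  is pending from the code before \<open>c\<close>; \<open>pending b c\<close> tells whether one is pending after it.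
\<close>

fun pending :: "bool \<Rightarrow> ('w, 'reg, 'lab) code \<Rightarrow> bool" where
  "pending b [] = b"
| "pending b ((l, Some I) # c) = pending False c"
| "pending b ((l, None) # c) = pending (b \<or> l \<noteq> None) c"

fun unclashed :: "bool \<Rightarrow> ('w, 'reg, 'lab) code \<Rightarrow> bool" where
  "unclashed b [] = True"
| "unclashed b ((l, Some I) # c) = ((b \<longrightarrow> l = None) \<and> unclashed False c)"
| "unclashed b ((l, None) # c) = ((b \<longrightarrow> l = None) \<and> unclashed (b \<or> l \<noteq> None) c)"

lemma pending_append [simp]: "pending b (c @ d) = pending (pending b c) d"
  by (induction b c rule: pending.induct) auto

lemma unclashed_append [simp]:
  "unclashed b (c @ d) \<longleftrightarrow> unclashed b c \<and> unclashed (pending b c) d"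
  by (induction b c rule: pending.induct) auto

lemma nops_first: "\<exists>b c. nops n = (None, b) # c"
  by (cases n) (auto simp: nops_def)

text \<open>\<open>nops 0\<close> is a single empty instruction, so a label attached to it stays
  pending until the real instruction \<open>I\<close> that follows. This is why \<open>I\<close> is
  part of the statement.\<close>

lemma attach_nops_unclashed:
  "unclashed False (attach l (nops n) @ [ins I]) \<and> \<not> pending False (attach l (nops n) @ [ins I])"
proof (cases n)
  case 0
  then show ?thesis by (cases l) (auto simp: nops_def)
next
  case (Suc m)
  have "\<not> pending False (replicate m (ins Nop)) \<and> unclashed False (replicate m (ins Nop))"
    by (induction m) auto
  then show ?thesis by (cases l) (auto simp: nops_def Suc)
qed

section \<open>Occurrence of code at a position of a program\<close>

definition labelled_at :: "('w, 'reg, 'lab) program \<Rightarrow> 'lab \<Rightarrow> nat \<Rightarrow> bool" where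
  "labelled_at Pr x p \<longleftrightarrow> p < length Pr \<and> fst (Pr ! p) = Some x"

text \<open>A \<open>None\<close> leaves the label at the position open, because assembling may have
  moved a label there from an empty instruction before it. An empty instruction occupies no position
  and puts its label on the next one.\<close>

fun placed :: "('w, 'reg, 'lab) program \<Rightarrow> nat \<Rightarrow> ('w, 'reg, 'lab) code \<Rightarrow> bool" where
  "placed Pr p [] = True"
| "placed Pr p ((l, Some I) # c) =
     ((\<forall>x. l = Some x \<longrightarrow> labelled_at Pr x p) \<and> p < length Pr \<and> snd (Pr ! p) = I \<and>
      placed Pr (Suc p) c)"
| "placed Pr p ((l, None) # c) = ((\<forall>x. l = Some x \<longrightarrow> labelled_at Pr x p) \<and> placed Pr p c)"

lemma placed_append [simp]:
  "placed Pr p (c @ d) \<longleftrightarrow> placed Pr p c \<and> placed Pr (p + length (assemble c)) d"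
  by (induction Pr p c rule: placed.induct) auto

lemma placed_first: "placed Pr p ((l, b) # c) \<Longrightarrow> l = Some x \<Longrightarrow> labelled_at Pr x p"
  by (cases b) auto

text \<open>\<open>attach\<close> overwrites the label of the first entry; that entry is unlabelled,
  so nothing is lost.\<close>

lemma placed_attach:
  assumes "\<exists>b d. c = (None, b) # d"
  shows "placed Pr p (attach l c) \<longleftrightarrow> placed Pr p c \<and> (\<forall>x. l = Some x \<longrightarrow> labelled_at Pr x p)"
proof -
  obtain b d where "c = (None, b) # d" using assms by blast
  then show ?thesis by (cases l; cases b; auto)
qed

lemma placed_instr:
  "placed Pr p c \<Longrightarrow> p \<le> i \<Longrightarrow> i < p + length (assemble c) \<Longrightarrow>
   i < length Pr \<and> snd (Pr ! i) \<in> instrs c"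
proof (induction Pr p c rule: placed.induct)
  case (2 Pr p l I c)
  then show ?case by (cases "i = p") auto
qed auto

text \<open>The induction meets code to which a label from an earlier empty instruction is still to
  be attached; \<open>l\<close> is that label, and \<open>b\<close> permits it. A pending label
  needs an instruction to land on, hence the nonemptiness claim.\<close>

lemma placed_assemble:
  assumes "unclashed b c" "\<not> pending b c" and "l \<noteq> None \<longrightarrow> b"
  shows "placed (pre @ attach l (assemble c)) (length pre) c \<and> (b \<longrightarrow> assemble c \<noteq> [])"
  using assms
proof (induction b c arbitrary: pre l rule: pending.induct)
  case (2 b m I c)
  have "placed ((pre @ [(k, I)]) @ attach None (assemble c)) (length (pre @ [(k, I)])) c" for k
    using 2 by (intro "2.IH"[THEN conjunct1]) auto
  then have *: "placed (pre @ (k, I) # assemble c) (Suc (length pre)) c" for k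
    by simp
  show ?case
  proof (cases l)
    case None
    then show ?thesis using * by (auto simp: labelled_at_def)
  next
    case (Some x)
    then have "m = None" using 2 by auto
    then show ?thesis using * Some by (auto simp: labelled_at_def)
  qed
next
  case (3 b m c)
  show ?case
  proof (cases m)
    case None
    then show ?thesis using 3 by auto
  next
    case (Some x)
    then have "l = None" using 3 by auto
    have "placed (pre @ attach (Some x) (assemble c)) (length pre) c \<and> assemble c \<noteq> []"
      using 3 Some by auto
    moreover obtain k I d where "assemble c = (k, I) # d"
      using calculation by (cases "assemble c") auto
    ultimately show ?thesis using Some \<open>l = None\<close> by (auto simp: labelled_at_def)
  qed
qed auto

text \<open>Empty instructions hand their labels on to unlabelled instructions, which is the second
  conjunct, so the list of labels survives assembling. Distinctness of labels thus carries over to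
  the program.\<close>

lemma map_filter_fst_assemble:
  assumes "unclashed b c" "\<not> pending b c"
  shows "List.map_filter fst (assemble c) = List.map_filter fst c \<and>
    (b \<longrightarrow> (\<exists>I d. assemble c = (None, I) # d))"
  using assms
proof (induction b c rule: pending.induct)
  case (3 b m c)
  then have IH: "List.map_filter fst (assemble c) = List.map_filter fst c"
    "b \<or> m \<noteq> None \<longrightarrow> (\<exists>I d. assemble c = (None, I) # d)" by auto
  show ?case
  proof (cases m)
    case None
    then show ?thesis using IH by (auto simp: List.map_filter_def)
  next
    case (Some x)
    then obtain I d where "assemble c = (None, I) # d" using IH by blast
    then show ?thesis using IH Some 3 by (auto simp: List.map_filter_def)
  qed
qed (auto simp: List.map_filter_def)

lemma labelled_at_in_labels: "labelled_at Pr x k \<Longrightarrow> x \<in> set (List.map_filter fst Pr)"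
  using nth_mem[of k Pr] by (force simp: labelled_at_def List.map_filter_def)

lemma labelled_at_unique:
  assumes "distinct (List.map_filter fst Pr)" "labelled_at Pr x p" "labelled_at Pr x q"
  shows "p = q"
  using assms
proof (induction Pr arbitrary: p q)
  case (Cons a Pr)
  note in_tail = labelled_at_in_labels[of Pr x]
  show ?case
  proof (cases p)
    case 0
    then show ?thesis
      using Cons.prems in_tail[of "q - 1"]
      by (cases q) (auto simp: labelled_at_def List.map_filter_def)
  next
    case (Suc p')
    note p = this
    show ?thesis
    proof (cases q)
      case 0
      then show ?thesis
        using Cons.prems in_tail[of p'] p by (auto simp: labelled_at_def List.map_filter_def)
    next
      case (Suc q')
      then show ?thesis
        using Cons.prems Cons.IH[of p' q'] p
        by (auto simp: labelled_at_def List.map_filter_def split: option.splits if_splits)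
    qed
  qed
qed (auto simp: labelled_at_def)


section \<open>Labels of compiled code\<close>

lemma compile_expr_first:
  "compile_expr v2p vl rl \<Phi> A l E P tp r \<Phi>' \<Longrightarrow> \<exists>b c. P = (l, b) # c"
  by (induction rule: compile_expr.induct) auto

text \<open>A cached variable compiles to an empty instruction, so a label can still be pending
  after the code of an expression; a command always ends with a real instruction.\<close>

lemma compile_expr_unclashed:
  "compile_expr v2p vl rl \<Phi> A l E P tp r \<Phi>' \<Longrightarrow> (b \<longrightarrow> l = None) \<Longrightarrow> unclashed b P"
  by (induction arbitrary: b rule: compile_expr.induct) auto

lemma compile_first:
  "compile v2p vl rl \<Phi> l C P tp l' \<Phi>' \<Longrightarrow> \<exists>b c. P = (l, b) # c"
proof (induction rule: compile.induct)
  case (while lam x r \<Phi>\<^sub>B \<Phi> \<Phi>\<^sub>E C P w t l' P\<^sub>i l lp ex Q)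
  then show ?case by (cases l) auto
qed (auto dest!: compile_expr_first)

lemma distinct_labels_single: "distinct_labels [(l, b)]"
  by (auto simp: distinct_labels_def List.map_filter_def)

lemma compile_distinct_labels:
  "compile v2p vl rl \<Phi> l C P tp l' \<Phi>' \<Longrightarrow> distinct_labels P"
  by (induction rule: compile.induct) (simp_all add: distinct_labels_single)

text \<open>If the first entry is empty, the attached label becomes pending for the rest of the
  code, and the hypotheses with \<open>True\<close> apply; otherwise it is absorbed at once.\<close>

lemma unclashed_attach_first:
  assumes "c = (None, b) # d" "unclashed True c" "unclashed False c"
    "\<not> pending True c" "\<not> pending False c"
  shows "unclashed False (attach l c) \<and> \<not> pending False (attach l c)"
  using assms by (cases l; cases b) auto

lemma compile_unclashed:
  "compile v2p vl rl \<Phi> l C P tp l' \<Phi>' \<Longrightarrow> (b \<longrightarrow> l = None) \<Longrightarrow> unclashed b P \<and> \<not> pending b P"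
proof (induction arbitrary: b rule: compile.induct)
  case (if_any \<Phi> l E P\<^sub>0 lam n\<^sub>0 r \<Phi>\<^sub>1 C\<^sub>1 P\<^sub>1 w\<^sub>1 t\<^sub>1 l\<^sub>1 \<Phi>\<^sub>2 C\<^sub>2 P\<^sub>2 w\<^sub>2 t\<^sub>2 l\<^sub>2 \<Phi>\<^sub>3 br ex Q)
  obtain d e where "P\<^sub>2 = (None, d) # e" using compile_first[OF if_any.hyps(4)] by blast
  then have "unclashed False (attach (Some br) P\<^sub>2) \<and> \<not> pending False (attach (Some br) P\<^sub>2)"
    using if_any.IH(2) by (intro unclashed_attach_first) auto
  then show ?case
    using if_any.IH compile_expr_unclashed[OF if_any.hyps(1), of b] if_any by auto
next
  case (if_H \<Phi> l E P\<^sub>0 n\<^sub>0 r \<Phi>\<^sub>1 C\<^sub>1 P\<^sub>1 n\<^sub>1 l\<^sub>1 \<Phi>\<^sub>2 C\<^sub>2 P\<^sub>2 n\<^sub>2 l\<^sub>2 \<Phi>\<^sub>3 m br ex Q)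
  obtain d e where "P\<^sub>2 = (None, d) # e" using compile_first[OF if_H.hyps(3)] by blast
  then have "unclashed False (attach (Some br) P\<^sub>2) \<and> \<not> pending False (attach (Some br) P\<^sub>2)"
    using if_H.IH(2) by (intro unclashed_attach_first) auto
  then show ?case
    using if_H.IH compile_expr_unclashed[OF if_H.hyps(1), of b] if_H.prems
      attach_nops_unclashed[of l\<^sub>1 "n\<^sub>2 - n\<^sub>1" "Jmp ex"] attach_nops_unclashed[of l\<^sub>2 "n\<^sub>1 - n\<^sub>2" Nop]
    unfolding if_H.hyps(6) by simp
next
  case (while lam x r \<Phi>\<^sub>B \<Phi> \<Phi>\<^sub>E C P w t l' P\<^sub>i l lp ex Q)
  then show ?case by (cases l; cases l') auto
qed (auto dest: compile_expr_unclashed)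

section \<open>Labels that mark instructions, and exit labels\<close>

lemma labels_simps [simp]:
  "labels [] = {}"
  "labels ((l, b) # c) = set_option l \<union> \<Union> (targets ` set_option b) \<union> labels c"
  "labels (c @ d) = labels c \<union> labels d"
  by (auto simp: labels_def)

text \<open>In contrast to \<open>labels\<close>, jump targets do not count; an exit label lies in
  \<open>labels\<close> only.\<close>

definition code_labels :: "('w, 'reg, 'lab) code \<Rightarrow> 'lab set" where
  "code_labels c = set (List.map_filter fst c)"

lemma code_labels_simps [simp]:
  "code_labels [] = {}"
  "code_labels ((l, b) # c) = set_option l \<union> code_labels c"
  "code_labels (c @ d) = code_labels c \<union> code_labels d"
  by (auto simp: code_labels_def List.map_filter_def split: option.splits)

lemma code_labels_subset: "code_labels c \<subseteq> labels c"
  by (induction c) auto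

lemma code_labels_attach: "code_labels (attach l c) \<subseteq> set_option l \<union> code_labels c"
  by (cases "(l, c)" rule: attach.cases) auto

lemma code_labels_nops [simp]: "code_labels (nops n) = {}"
  by (auto simp: nops_def code_labels_def List.map_filter_def)

text \<open>Conditionals and loops generate their exit label fresh and jump to it without placing
  it. Membership in \<open>labels P\<close> lets the disjointness condition of an enclosing rule
  separate it from the labels introduced there.\<close>

lemma compile_exit_label:
  "compile v2p vl rl \<Phi> l C P tp l' \<Phi>' \<Longrightarrow> l' = Some x \<Longrightarrow> x \<notin> code_labels P \<and> x \<in> labels P"
proof (induction arbitrary: x rule: compile.induct)
  case (if_any \<Phi> l E P\<^sub>0 lam n\<^sub>0 r \<Phi>\<^sub>1 C\<^sub>1 P\<^sub>1 w\<^sub>1 t\<^sub>1 l\<^sub>1 \<Phi>\<^sub>2 C\<^sub>2 P\<^sub>2 w\<^sub>2 t\<^sub>2 l\<^sub>2 \<Phi>\<^sub>3 br ex Q)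
  have "set_option l\<^sub>1 \<subseteq> labels P\<^sub>1" "set_option l\<^sub>2 \<subseteq> labels P\<^sub>2"
    using if_any.IH by auto
  then show ?case
    using if_any.prems if_any.hyps(6) code_labels_subset[of P\<^sub>0] code_labels_subset[of P\<^sub>1]
      code_labels_subset[of P\<^sub>2] code_labels_attach[of "Some br" P\<^sub>2]
    unfolding if_any.hyps(7) by (auto simp: disjnt_def)
next
  case (if_H \<Phi> l E P\<^sub>0 n\<^sub>0 r \<Phi>\<^sub>1 C\<^sub>1 P\<^sub>1 n\<^sub>1 l\<^sub>1 \<Phi>\<^sub>2 C\<^sub>2 P\<^sub>2 n\<^sub>2 l\<^sub>2 \<Phi>\<^sub>3 m br ex Q)
  have "set_option l\<^sub>1 \<subseteq> labels P\<^sub>1" "set_option l\<^sub>2 \<subseteq> labels P\<^sub>2"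
    using if_H.IH by auto
  then show ?case
    using if_H.prems if_H.hyps(5) code_labels_subset[of P\<^sub>0] code_labels_subset[of P\<^sub>1]
      code_labels_subset[of P\<^sub>2] code_labels_attach[of "Some br" P\<^sub>2]
      code_labels_attach[of l\<^sub>1 "nops (n\<^sub>2 - n\<^sub>1)"] code_labels_attach[of l\<^sub>2 "nops (n\<^sub>1 - n\<^sub>2)"]
    unfolding if_H.hyps(6) by (auto simp: disjnt_def)
next
  case (seq \<Phi> l C\<^sub>1 P\<^sub>1 w\<^sub>1 t\<^sub>1 l\<^sub>1 \<Phi>\<^sub>1 C\<^sub>2 P\<^sub>2 w\<^sub>2 t\<^sub>2 l\<^sub>2 \<Phi>\<^sub>2)
  \<comment> \<open>The two pieces can share only \<open>l\<^sub>1\<close>, which marks the start of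
    \<open>P\<^sub>2\<close>. The exit label of \<open>P\<^sub>2\<close> marks nothing in
    \<open>P\<^sub>2\<close>, so it differs from \<open>l\<^sub>1\<close> and cannot occur in
    \<open>P\<^sub>1\<close>.\<close>
  have "set_option l\<^sub>1 \<subseteq> code_labels P\<^sub>2" using compile_first[OF seq.hyps(2)] by auto
  then show ?case using seq.IH(2)[OF seq.prems] seq.hyps(4) code_labels_subset[of P\<^sub>1] by auto
next
  case (while lam x r \<Phi>\<^sub>B \<Phi> \<Phi>\<^sub>E C P w t l' P\<^sub>i l lp ex Q)
  have "set_option l' \<subseteq> labels P" using while.IH by auto
  then show ?case
    using while.prems while.hyps(9) code_labels_subset[of P] code_labels_attach[of l P\<^sub>i]
      code_labels_attach[of l' P\<^sub>i]
    unfolding while.hyps(10) by (auto simp: disjnt_def while.hyps(8))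
qed auto


section \<open>Positions and their bisimulation\<close>

locale machine =
  fixes Pr :: "('w::semiring_1, 'reg, 'lab) program"
    and v2p :: "'var \<Rightarrow> 'w" and vl :: "'var \<Rightarrow> level" and rl :: "'reg \<Rightarrow> level"
  assumes inj_v2p: "inj v2p"
    and fits: "fits Pr"
    and distinct: "distinct (List.map_filter fst Pr)"
begin

abbreviation low_equiv (infix \<open>=\<^sub>L\<close> 50) where
  "s =\<^sub>L s' \<equiv> low_eq v2p vl rl s s'"

lemma low_eq_sym: "s =\<^sub>L s' \<Longrightarrow> s' =\<^sub>L s"
  by (auto simp: low_eq_def)

lemma low_eq_trans: "s =\<^sub>L s' \<Longrightarrow> s' =\<^sub>L s'' \<Longrightarrow> s =\<^sub>L s''"
  by (auto simp: low_eq_def)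

abbreviation low_cell :: "'w \<Rightarrow> bool" where
  "low_cell k \<equiv> \<exists>x. vl x = L \<and> k = v2p x"

lemma low_cell_v2p [simp]: "low_cell (v2p x) \<longleftrightarrow> vl x = L"
  using inj_v2p by (auto dest: injD)

fun invisible :: "('w, 'reg, 'lab) instr \<Rightarrow> bool" where
  "invisible (Load r k) = (rl r = H)"
| "invisible (Store k r) = (\<not> low_cell k)"
| "invisible (Movek r k) = (rl r = H)"
| "invisible (Mover r r') = (rl r = H)"
| "invisible (Op f r r') = (rl r = H)"
| "invisible (Out ch r) = (ch = High)"
| "invisible _ = True"

text \<open>Low effects are allowed, as long as low-equal states produce the same ones and continue
  at the same position; for \<open>Jz\<close> the latter means testing a low register.\<close>

fun noninterfering :: "('w, 'reg, 'lab) instr \<Rightarrow> bool" where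
  "noninterfering (Load r k) = (rl r = L \<longrightarrow> low_cell k)"
| "noninterfering (Store k r) = (low_cell k \<longrightarrow> rl r = L)"
| "noninterfering (Jz x r) = (rl r = L)"
| "noninterfering (Mover r r') = (rl r = L \<longrightarrow> rl r' = L)"
| "noninterfering (Op f r r') = (rl r = L \<longrightarrow> rl r' = L)"
| "noninterfering (Out ch r) = (ch = Low \<longrightarrow> rl r = L)"
| "noninterfering _ = True"

section \<open>Transitions at numbered positions\<close>

lemma fetch_of_nat:
  assumes "i \<le> length Pr"
  shows "fetch Pr (of_nat i) = (if i < length Pr then Some (snd (Pr ! i)) else None)"
proof -
  have inj: "j = i" if "of_nat j = (of_nat i :: 'w)" "j \<le> length Pr" for j
    using fits assms that by (auto simp: fits_def dest: inj_onD)
  have "(LEAST j. of_nat j = (of_nat i :: 'w)) = i"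
  proof (rule Least_equality)
    \<comment> \<open>Words may wrap around, so a \<open>j\<close> beyond the program can denote the
      same word; such a \<open>j\<close> is still not below \<open>i\<close>.\<close>
    fix j assume "of_nat j = (of_nat i :: 'w)"
    then show "i \<le> j" using inj[of j] assms by (cases "j \<le> length Pr") auto
  qed simp
  moreover have "(\<exists>j<length Pr. of_nat j = (of_nat i :: 'w)) \<longleftrightarrow> i < length Pr"
    using inj by (metis less_imp_le)
  ultimately show ?thesis by (simp add: fetch_def)
qed

lemma resolve_Some: "labelled_at Pr x p \<Longrightarrow> resolve Pr x = Some (of_nat p)"
  using labelled_at_unique[OF distinct] LeastI[of "\<lambda>i. i < length Pr \<and> fst (Pr ! i) = Some x" p]
  unfolding resolve_def labelled_at_def by (auto intro: arg_cong[of _ _ of_nat])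

lemma resolve_None: "\<nexists>p. labelled_at Pr x p \<Longrightarrow> resolve Pr x = None"
  by (auto simp: resolve_def labelled_at_def)

text \<open>A stuck position counts as its own successor, as in the relation \<open>step_inf\<close>.\<close>

definition jumps :: "'lab \<Rightarrow> nat \<Rightarrow> nat set" where
  "jumps x i = (if \<exists>p. labelled_at Pr x p then {p. labelled_at Pr x p} else {i})"

definition nexts :: "nat \<Rightarrow> nat set" where
  "nexts i = (if i < length Pr then
      (case snd (Pr ! i) of
        Jmp x \<Rightarrow> jumps x i | Jz x r \<Rightarrow> insert (Suc i) (jumps x i) | _ \<Rightarrow> {Suc i})
    else {i})"

lemma jumps_labelled: "labelled_at Pr x p \<Longrightarrow> jumps x i = {p}"
  using labelled_at_unique[OF distinct] by (auto simp: jumps_def)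

lemma jumps_bound: "j \<in> jumps x i \<Longrightarrow> i \<le> length Pr \<Longrightarrow> j \<le> length Pr"
  by (auto simp: jumps_def labelled_at_def split: if_splits)

lemma nexts_bound: "i \<le> length Pr \<Longrightarrow> j \<in> nexts i \<Longrightarrow> j \<le> length Pr"
  by (auto simp: nexts_def jumps_bound split: if_splits instr.splits)

lemma jumps_cases:
  obtains p where "labelled_at Pr x p" "jumps x i = {p}" "resolve Pr x = Some (of_nat p)"
  | "jumps x i = {i}" "resolve Pr x = None"
proof (cases "\<exists>p. labelled_at Pr x p")
  case True
  then show ?thesis using that(1) jumps_labelled resolve_Some by blast
next
  case False
  then show ?thesis using that(2) resolve_None by (simp add: jumps_def)
qed

inductive_cases step_from: "step (Pr, pc, R, M) a s"

lemma step_iff: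
  assumes "i < length Pr"
  shows "step (Pr, of_nat i, R, M) a (Q, pc', R', M') \<longleftrightarrow> Q = Pr \<and>
    (case snd (Pr ! i) of
      Load r k \<Rightarrow> a = Tau \<and> pc' = of_nat i + 1 \<and> R' = R(r := M k) \<and> M' = M
    | Store k r \<Rightarrow> a = Tau \<and> pc' = of_nat i + 1 \<and> R' = R \<and> M' = M(k := R r)
    | Jmp x \<Rightarrow> a = Tau \<and> resolve Pr x = Some pc' \<and> R' = R \<and> M' = M
    | Jz x r \<Rightarrow> a = Tau \<and> R' = R \<and> M' = M \<and>
        (if R r = 0 then resolve Pr x = Some pc' else pc' = of_nat i + 1)
    | Nop \<Rightarrow> a = Tau \<and> pc' = of_nat i + 1 \<and> R' = R \<and> M' = M
    | Movek r k \<Rightarrow> a = Tau \<and> pc' = of_nat i + 1 \<and> R' = R(r := k) \<and> M' = M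
    | Mover r r' \<Rightarrow> a = Tau \<and> pc' = of_nat i + 1 \<and> R' = R(r := R r') \<and> M' = M
    | Op f r r' \<Rightarrow> a = Tau \<and> pc' = of_nat i + 1 \<and> R' = R(r := f (R r) (R r')) \<and> M' = M
    | Out ch r \<Rightarrow> a = Output ch (R r) \<and> pc' = of_nat i + 1 \<and> R' = R \<and> M' = M)"
proof -
  have f: "fetch Pr (of_nat i) = Some (snd (Pr ! i))" using assms by (simp add: fetch_of_nat)
  show ?thesis
    by (cases "snd (Pr ! i)") (auto simp: f intro: step.intros elim!: step_from split: if_splits)
qed

lemma step_end: "\<not> step (Pr, of_nat (length Pr), R, M) a s"
  by (auto simp: fetch_of_nat elim: step_from)

lemma step_inf_end: "step_inf (Pr, of_nat (length Pr), R, M) a s \<longleftrightarrow>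
   a = Tau \<and> s = (Pr, of_nat (length Pr), R, M)"
  by (auto simp: step_inf_def stuck_def step_end)

text \<open>Only a jump to an unresolved label can be stuck inside the program, and
  \<open>jumps\<close> already contains the resulting self-loop, so stuckness needs no separate
  case.\<close>

lemma step_inf_iff:
  assumes "i < length Pr"
  shows "step_inf (Pr, of_nat i, R, M) a (Q, pc', R', M') \<longleftrightarrow> Q = Pr \<and>
    (case snd (Pr ! i) of
      Load r k \<Rightarrow> a = Tau \<and> pc' = of_nat (Suc i) \<and> R' = R(r := M k) \<and> M' = M
    | Store k r \<Rightarrow> a = Tau \<and> pc' = of_nat (Suc i) \<and> R' = R \<and> M' = M(k := R r)
    | Jmp x \<Rightarrow> a = Tau \<and> pc' \<in> of_nat ` jumps x i \<and> R' = R \<and> M' = M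
    | Jz x r \<Rightarrow> a = Tau \<and> R' = R \<and> M' = M \<and>
        (if R r = 0 then pc' \<in> of_nat ` jumps x i else pc' = of_nat (Suc i))
    | Nop \<Rightarrow> a = Tau \<and> pc' = of_nat (Suc i) \<and> R' = R \<and> M' = M
    | Movek r k \<Rightarrow> a = Tau \<and> pc' = of_nat (Suc i) \<and> R' = R(r := k) \<and> M' = M
    | Mover r r' \<Rightarrow> a = Tau \<and> pc' = of_nat (Suc i) \<and> R' = R(r := R r') \<and> M' = M
    | Op f r r' \<Rightarrow> a = Tau \<and> pc' = of_nat (Suc i) \<and> R' = R(r := f (R r) (R r')) \<and> M' = M
    | Out ch r \<Rightarrow> a = Output ch (R r) \<and> pc' = of_nat (Suc i) \<and> R' = R \<and> M' = M)"
proof (cases "snd (Pr ! i)")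
  case (Jmp x)
  then show ?thesis
    by (cases rule: jumps_cases[of x i]) (auto simp: step_inf_def stuck_def step_iff[OF assms])
next
  case (Jz x r)
  then show ?thesis
    by (cases rule: jumps_cases[of x i])
      (auto simp: step_inf_def stuck_def step_iff[OF assms] add.commute)
qed (auto simp: step_inf_def stuck_def step_iff[OF assms] add.commute)

lemma step_inf_total:
  assumes "i \<le> length Pr"
  shows "\<exists>a pc' R' M'. step_inf (Pr, of_nat i, R, M) a (Pr, pc', R', M')"
proof -
  obtain a Q pc' R' M' where s: "step_inf (Pr, of_nat i, R, M) a (Q, pc', R', M')"
    unfolding step_inf_def stuck_def by (metis prod_cases4)
  then have "Q = Pr"
    using assms by (cases "i = length Pr") (auto simp: step_inf_end step_inf_iff)
  then show ?thesis using s by blast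
qed

lemma step_inf_invisible:
  assumes "i \<le> length Pr" "i < length Pr \<longrightarrow> invisible (snd (Pr ! i))"
    and "step_inf (Pr, of_nat i, R, M) a (Pr, pc', R', M')"
  shows "low a = Tau \<and> (R, M) =\<^sub>L (R', M') \<and> (\<exists>j\<in>nexts i. pc' = of_nat j)"
proof (cases "i < length Pr")
  case True
  then show ?thesis using assms
    by (cases "snd (Pr ! i)") (auto simp: step_inf_iff nexts_def low_eq_def split: if_splits)
next
  case False
  then show ?thesis using assms by (auto simp: step_inf_end nexts_def low_eq_def)
qed

text \<open>Only \<open>Jz\<close> chooses its successor by data, and here it tests a low register,
  so both runs arrive at the same \<open>pc'\<close>.\<close>

lemma step_inf_noninterfering:
  assumes "i \<le> length Pr" "i < length Pr \<longrightarrow> noninterfering (snd (Pr ! i))"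
    and "(R\<^sub>1, M\<^sub>1) =\<^sub>L (R\<^sub>2, M\<^sub>2)"
    and "step_inf (Pr, of_nat i, R\<^sub>1, M\<^sub>1) a (Pr, pc', R\<^sub>1', M\<^sub>1')"
  shows "\<exists>b R\<^sub>2' M\<^sub>2'. step_inf (Pr, of_nat i, R\<^sub>2, M\<^sub>2) b (Pr, pc', R\<^sub>2', M\<^sub>2') \<and> low a = low b \<and>
    (R\<^sub>1', M\<^sub>1') =\<^sub>L (R\<^sub>2', M\<^sub>2') \<and> (\<exists>j\<in>nexts i. pc' = of_nat j)"
proof (cases "i < length Pr")
  case True
  show ?thesis
  proof (cases "snd (Pr ! i)")
    case (Out ch r)
    then show ?thesis using assms True
      by (cases ch) (auto simp: step_inf_iff nexts_def low_eq_def)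
  qed (use assms True in \<open>auto simp: step_inf_iff nexts_def low_eq_def split: if_splits\<close>)
next
  case False
  then show ?thesis using assms by (auto simp: step_inf_end nexts_def)
qed

section \<open>Invisible regions, lockstep and synchronised positions\<close>

coinductive high :: "nat \<Rightarrow> bool" where
  "(i < length Pr \<longrightarrow> invisible (snd (Pr ! i))) \<Longrightarrow> (\<forall>j\<in>nexts i. high j) \<Longrightarrow> high i"

text \<open>The step count is the same along all paths, whatever the registers hold, as a timing
  \<open>Trm n\<close> promises.\<close>

fun lockstep :: "nat \<Rightarrow> nat \<Rightarrow> nat \<Rightarrow> bool" where
  "lockstep 0 i e = (i = e)"
| "lockstep (Suc n) i e =
     (i < length Pr \<and> invisible (snd (Pr ! i)) \<and> (\<forall>j\<in>nexts i. lockstep n j e))"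

definition synced :: "nat \<Rightarrow> nat \<Rightarrow> bool" where
  "synced i j \<longleftrightarrow> high i \<and> high j \<or> (\<exists>n e. lockstep n i e \<and> lockstep n j e)"

text \<open>The second alternative is meant for branches on high data: low-equal states may choose
  different successors, so any two of them have to be related.\<close>

definition good :: "nat \<Rightarrow> bool" where
  "good i \<longleftrightarrow> (i < length Pr \<longrightarrow> noninterfering (snd (Pr ! i)) \<or>
     invisible (snd (Pr ! i)) \<and> (\<forall>j\<in>nexts i. \<forall>k\<in>nexts i. synced j k))"

lemma synced_refl: "synced i i"
  unfolding synced_def by (metis lockstep.simps(1))

lemma synced_sym: "synced i j \<Longrightarrow> synced j i"
  by (auto simp: synced_def)

lemma high_good: "high i \<Longrightarrow> good i"
  by (auto simp: good_def synced_def elim: high.cases)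

lemma lockstep_good: "lockstep (Suc n) i e \<Longrightarrow> good i"
  by (auto simp: good_def synced_def)

text \<open>Lockstep with no steps left puts both positions at the common end. Otherwise both steps
  are invisible, and their successors stay high or have one step less to go.\<close>

lemma synced_cases:
  assumes "synced i j"
  obtains "i = j"
  | "i < length Pr \<longrightarrow> invisible (snd (Pr ! i))" "j < length Pr \<longrightarrow> invisible (snd (Pr ! j))"
    "\<And>i' j'. i' \<in> nexts i \<Longrightarrow> j' \<in> nexts j \<Longrightarrow> synced i' j'"
proof -
  consider "high i" "high j" | n e where "lockstep n i e" "lockstep n j e"
    using assms by (auto simp: synced_def)
  then show thesis
  proof cases
    case 1
    then show ?thesis
      by (intro that(2)) (auto simp: synced_def elim: high.cases)
  next
    case 2
    show ?thesis
    proof (cases n)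
      case 0
      then show ?thesis using 2 by (intro that(1)) auto
    next
      case (Suc m)
      then show ?thesis using 2 by (intro that(2)) (auto simp: synced_def)
    qed
  qed
qed

lemma bisimulation:
  assumes good: "\<And>i. i < length Pr \<Longrightarrow> good i"
  shows "strong_bisimulation v2p vl rl
    {((Pr, of_nat i), (Pr, of_nat j)) | i j. i \<le> length Pr \<and> j \<le> length Pr \<and> synced i j}"
    (is "strong_bisimulation _ _ _ ?B")
  unfolding strong_bisimulation_def
proof (intro conjI allI impI)
  show "sym ?B" by (auto simp: sym_def intro: synced_sym)
next
  fix P\<^sub>1 pc\<^sub>1 P\<^sub>2 pc\<^sub>2 R\<^sub>1 M\<^sub>1 R\<^sub>2 M\<^sub>2 a pc\<^sub>1' R\<^sub>1' M\<^sub>1'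
  assume B: "((P\<^sub>1, pc\<^sub>1), (P\<^sub>2, pc\<^sub>2)) \<in> ?B"
    and low: "(R\<^sub>1, M\<^sub>1) =\<^sub>L (R\<^sub>2, M\<^sub>2)"
    and step: "step_inf (P\<^sub>1, pc\<^sub>1, R\<^sub>1, M\<^sub>1) a (P\<^sub>1, pc\<^sub>1', R\<^sub>1', M\<^sub>1')"
  obtain i j where eq: "P\<^sub>1 = Pr" "P\<^sub>2 = Pr" "pc\<^sub>1 = of_nat i" "pc\<^sub>2 = of_nat j"
    and le: "i \<le> length Pr" "j \<le> length Pr" and sync: "synced i j"
    using B by auto
  let ?goal = "\<exists>b pc\<^sub>2' R\<^sub>2' M\<^sub>2'.
    step_inf (P\<^sub>2, pc\<^sub>2, R\<^sub>2, M\<^sub>2) b (P\<^sub>2, pc\<^sub>2', R\<^sub>2', M\<^sub>2') \<and> low a = low b \<and>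
    (R\<^sub>1', M\<^sub>1') =\<^sub>L (R\<^sub>2', M\<^sub>2') \<and> ((P\<^sub>1, pc\<^sub>1'), (P\<^sub>2, pc\<^sub>2')) \<in> ?B"
  \<comment> \<open>This serves two situations: positions that have already parted, and a single
    position holding a high branch, where goodness relates the successors.\<close>
  have invisible_case: ?goal
    if inv: "i < length Pr \<longrightarrow> invisible (snd (Pr ! i))" "j < length Pr \<longrightarrow> invisible (snd (Pr ! j))"
      and nxt: "\<And>i' j'. i' \<in> nexts i \<Longrightarrow> j' \<in> nexts j \<Longrightarrow> synced i' j'"
  proof -
    obtain b pc\<^sub>2' R\<^sub>2' M\<^sub>2' where step2: "step_inf (Pr, of_nat j, R\<^sub>2, M\<^sub>2) b (Pr, pc\<^sub>2', R\<^sub>2', M\<^sub>2')"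
      using step_inf_total[OF le(2)] by blast
    obtain i' where i': "low a = Tau" "(R\<^sub>1, M\<^sub>1) =\<^sub>L (R\<^sub>1', M\<^sub>1')" "i' \<in> nexts i" "pc\<^sub>1' = of_nat i'"
      using step_inf_invisible[OF le(1) inv(1)] step unfolding eq by blast
    obtain j' where j': "low b = Tau" "(R\<^sub>2, M\<^sub>2) =\<^sub>L (R\<^sub>2', M\<^sub>2')" "j' \<in> nexts j" "pc\<^sub>2' = of_nat j'"
      using step_inf_invisible[OF le(2) inv(2) step2] by blast
    have "(R\<^sub>1', M\<^sub>1') =\<^sub>L (R\<^sub>2', M\<^sub>2')"
      using i'(2) j'(2) low low_eq_sym low_eq_trans by blast
    moreover have "((Pr, pc\<^sub>1'), (Pr, pc\<^sub>2')) \<in> ?B"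
      using nxt i' j' nexts_bound le by blast
    ultimately show ?goal using step2 i'(1) j'(1) unfolding eq by fastforce
  qed
  show ?goal
    using sync
  proof (cases rule: synced_cases)
    case 1
    show ?thesis
    proof (cases "i < length Pr \<longrightarrow> noninterfering (snd (Pr ! i))")
      case True
      then obtain b R\<^sub>2' M\<^sub>2' k where k: "step_inf (Pr, of_nat i, R\<^sub>2, M\<^sub>2) b (Pr, pc\<^sub>1', R\<^sub>2', M\<^sub>2')"
        "low a = low b" "(R\<^sub>1', M\<^sub>1') =\<^sub>L (R\<^sub>2', M\<^sub>2')" "k \<in> nexts i" "pc\<^sub>1' = of_nat k"
        using step_inf_noninterfering[OF le(1) _ low] step unfolding eq by blast
      then have "((Pr, pc\<^sub>1'), (Pr, pc\<^sub>1')) \<in> ?B"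
        using nexts_bound[OF le(1)] synced_refl by blast
      then show ?thesis using k unfolding eq 1[symmetric] by blast
    next
      case False
      then show ?thesis using good[of i] 1 by (intro invisible_case) (auto simp: good_def)
    qed
  next
    case 2
    then show ?thesis by (rule invisible_case)
  qed
qed


section \<open>Positions of compiled code\<close>

text \<open>Rule \<open>C\<close> forces one level on the whole expression, so every register
  written has level \<open>fst tp\<close>, and a low register is loaded only from a low variable.
  The code is straight-line, so its length is its running time.\<close>

lemma compile_expr_instrs:
  "compile_expr v2p vl rl \<Phi> A l E P tp r \<Phi>' \<Longrightarrow>
   rl r = fst tp \<and> length (assemble P) = snd tp \<and>
   (\<forall>I\<in>instrs P. noninterfering I \<and> targets I = {} \<and> (fst tp = H \<longrightarrow> invisible I))"
  by (induction rule: compile_expr.induct) auto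

text \<open>For conditionals and loops, \<open>WrH\<close> forces a high guard, and the bound on the
  effects of the components then makes these \<open>WrH\<close> as well.\<close>

lemma compile_invisible:
  "compile v2p vl rl \<Phi> l C P tp l' \<Phi>' \<Longrightarrow> fst tp = WrH \<Longrightarrow> I \<in> instrs P \<Longrightarrow> invisible I"
proof (induction arbitrary: I rule: compile.induct)
  case (assign \<Phi> l E P x n r \<Phi>' Q tp)
  then show ?case by (auto dest!: compile_expr_instrs split: if_splits)
next
  case (out \<Phi> l E P ch n r \<Phi>' Q tp)
  then show ?case by (cases ch) (auto dest!: compile_expr_instrs split: if_splits)
next
  case (if_any \<Phi> l E P\<^sub>0 lam n\<^sub>0 r \<Phi>\<^sub>1 C\<^sub>1 P\<^sub>1 w\<^sub>1 t\<^sub>1 l\<^sub>1 \<Phi>\<^sub>2 C\<^sub>2 P\<^sub>2 w\<^sub>2 t\<^sub>2 l\<^sub>2 \<Phi>\<^sub>3 br ex Q)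
  then have "lam = H" by (cases lam) auto
  then show ?case using if_any compile_expr_instrs[OF if_any.hyps(1)] by auto
next
  case (if_H \<Phi> l E P\<^sub>0 n\<^sub>0 r \<Phi>\<^sub>1 C\<^sub>1 P\<^sub>1 n\<^sub>1 l\<^sub>1 \<Phi>\<^sub>2 C\<^sub>2 P\<^sub>2 n\<^sub>2 l\<^sub>2 \<Phi>\<^sub>3 m br ex Q)
  then show ?case
    using compile_expr_instrs[OF if_H.hyps(1)] instrs_nops[of "n\<^sub>2 - n\<^sub>1"] instrs_nops[of "n\<^sub>1 - n\<^sub>2"]
    by auto
next
  case (while lam x r \<Phi>\<^sub>B \<Phi> \<Phi>\<^sub>E C P w t l' P\<^sub>i l lp ex Q)
  then have "lam = H" by (cases lam) auto
  then show ?case using while by auto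
qed (auto split: if_splits)

text \<open>This is vacuous for a label that marks no instruction, as is the case for the exit label
  of the whole program.\<close>

definition exits_to :: "'lab option \<Rightarrow> nat \<Rightarrow> bool" where
  "exits_to l e \<longleftrightarrow> (\<forall>x q. l = Some x \<longrightarrow> labelled_at Pr x q \<longrightarrow> q = e)"

lemma exits_toI: "(\<And>x. l = Some x \<Longrightarrow> labelled_at Pr x e) \<Longrightarrow> exits_to l e"
  using labelled_at_unique[OF distinct] by (auto simp: exits_to_def)

lemma exits_toD: "labelled_at Pr x e \<Longrightarrow> labelled_at Pr x q \<Longrightarrow> q = e"
  using labelled_at_unique[OF distinct] by blast

text \<open>Resolved jumps stay in the block or go to its end: \<open>br\<close> and
  \<open>lp\<close> mark positions inside, and the exit label of a component marks the instruction
  right after it, which makes the induction hypotheses applicable.\<close>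

lemma compile_targets:
  "compile v2p vl rl \<Phi> l C P tp l' \<Phi>' \<Longrightarrow> placed Pr p P \<Longrightarrow>
   exits_to l' (p + length (assemble P)) \<Longrightarrow> I \<in> instrs P \<Longrightarrow> x \<in> targets I \<Longrightarrow> labelled_at Pr x q \<Longrightarrow>
   p \<le> q \<and> q \<le> p + length (assemble P)"
proof (induction arbitrary: p I x q rule: compile.induct)
  case (if_any \<Phi> l E P\<^sub>0 lam n\<^sub>0 r \<Phi>\<^sub>1 C\<^sub>1 P\<^sub>1 w\<^sub>1 t\<^sub>1 l\<^sub>1 \<Phi>\<^sub>2 C\<^sub>2 P\<^sub>2 w\<^sub>2 t\<^sub>2 l\<^sub>2 \<Phi>\<^sub>3 br ex Q)
  note Q = if_any.hyps(7)
  let ?p\<^sub>1 = "p + length (assemble P\<^sub>0) + 1"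
  let ?p\<^sub>2 = "?p\<^sub>1 + length (assemble P\<^sub>1) + 1"
  note P2 = placed_attach[OF compile_first[OF if_any.hyps(4)]]
  have pl: "placed Pr ?p\<^sub>1 P\<^sub>1" "placed Pr ?p\<^sub>2 P\<^sub>2" "labelled_at Pr br ?p\<^sub>2"
    using if_any.prems(1) unfolding Q by (auto simp: P2 add.assoc)
  have ex: "exits_to l\<^sub>1 (?p\<^sub>1 + length (assemble P\<^sub>1))" "exits_to l\<^sub>2 (?p\<^sub>2 + length (assemble P\<^sub>2))"
    using if_any.prems(1) unfolding Q by (auto intro!: exits_toI simp: add.assoc)
  consider "I \<in> instrs P\<^sub>0" | "I \<in> instrs P\<^sub>1" | "I \<in> instrs P\<^sub>2" | "x = br" | "x = ex"
    using if_any.prems unfolding Q by auto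
  then show ?case
  proof cases
    case 1
    then show ?thesis using compile_expr_instrs[OF if_any.hyps(1)] if_any.prems by auto
  next
    case 2
    then show ?thesis using if_any.IH(1)[OF pl(1) ex(1)] if_any.prems unfolding Q by fastforce
  next
    case 3
    then show ?thesis using if_any.IH(2)[OF pl(2) ex(2)] if_any.prems unfolding Q by fastforce
  next
    case 4
    then show ?thesis using exits_toD[OF pl(3)] if_any.prems unfolding Q by fastforce
  next
    case 5
    then show ?thesis using if_any.prems by (auto simp: exits_to_def)
  qed
next
  case (if_H \<Phi> l E P\<^sub>0 n\<^sub>0 r \<Phi>\<^sub>1 C\<^sub>1 P\<^sub>1 n\<^sub>1 l\<^sub>1 \<Phi>\<^sub>2 C\<^sub>2 P\<^sub>2 n\<^sub>2 l\<^sub>2 \<Phi>\<^sub>3 m br ex Q)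
  note Q = if_H.hyps(6)
  let ?p\<^sub>1 = "p + length (assemble P\<^sub>0) + 1"
  let ?p\<^sub>2 = "?p\<^sub>1 + length (assemble P\<^sub>1) + (n\<^sub>2 - n\<^sub>1) + 1"
  note P2 = placed_attach[OF compile_first[OF if_H.hyps(3)]]
  have pl: "placed Pr ?p\<^sub>1 P\<^sub>1" "placed Pr ?p\<^sub>2 P\<^sub>2" "labelled_at Pr br ?p\<^sub>2"
    using if_H.prems(1) unfolding Q by (auto simp: P2 add.assoc)
  have ex: "exits_to l\<^sub>1 (?p\<^sub>1 + length (assemble P\<^sub>1))" "exits_to l\<^sub>2 (?p\<^sub>2 + length (assemble P\<^sub>2))"
    using if_H.prems(1) unfolding Q
    by (auto intro!: exits_toI simp: placed_attach[OF nops_first] add.assoc)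
  consider "I \<in> instrs P\<^sub>0" | "I \<in> instrs P\<^sub>1" | "I \<in> instrs P\<^sub>2" | "x = br" | "x = ex"
    using if_H.prems instrs_nops[of "n\<^sub>2 - n\<^sub>1"] instrs_nops[of "n\<^sub>1 - n\<^sub>2"] unfolding Q by auto
  then show ?case
  proof cases
    case 1
    then show ?thesis using compile_expr_instrs[OF if_H.hyps(1)] if_H.prems by auto
  next
    case 2
    then show ?thesis using if_H.IH(1)[OF pl(1) ex(1)] if_H.prems unfolding Q by fastforce
  next
    case 3
    then show ?thesis using if_H.IH(2)[OF pl(2) ex(2)] if_H.prems unfolding Q by fastforce
  next
    case 4
    then show ?thesis using exits_toD[OF pl(3)] if_H.prems unfolding Q by fastforce
  next
    case 5
    then show ?thesis using if_H.prems by (auto simp: exits_to_def)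
  qed
next
  case (seq \<Phi> l C\<^sub>1 P\<^sub>1 w\<^sub>1 t\<^sub>1 l\<^sub>1 \<Phi>\<^sub>1 C\<^sub>2 P\<^sub>2 w\<^sub>2 t\<^sub>2 l\<^sub>2 \<Phi>\<^sub>2)
  have "exits_to l\<^sub>1 (p + length (assemble P\<^sub>1))"
    using seq.prems(1) compile_first[OF seq.hyps(2)] by (auto intro!: exits_toI dest: placed_first)
  then show ?case using seq.prems seq.IH(1)[of p I x q] seq.IH(2)[of "p + length (assemble P\<^sub>1)" I x q]
    by (auto simp: add.assoc)
next
  case (while lam y r \<Phi>\<^sub>B \<Phi> \<Phi>\<^sub>E C P w t l' P\<^sub>i l lp ex Q)
  note Q = while.hyps(10) and P\<^sub>i = while.hyps(8)
  \<comment> \<open>\<open>P\<^sub>i\<close> fills two positions, so the test labelled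
    \<open>lp\<close> sits at \<open>p + 2\<close> and the body starts at
    \<open>p + 3\<close>.\<close>
  let ?p\<^sub>1 = "p + 3"
  have first: "\<exists>b d. P\<^sub>i = (None, b) # d" by (simp add: P\<^sub>i)
  have size: "length (assemble P\<^sub>i) = 2" by (simp add: P\<^sub>i)
  have pl: "placed Pr ?p\<^sub>1 P" "labelled_at Pr lp (p + 2)"
    using while.prems(1) by (auto simp: Q size eval_nat_numeral)
  have ex: "exits_to l' (?p\<^sub>1 + length (assemble P))"
    using while.prems(1) by (auto intro!: exits_toI simp: Q placed_attach[OF first] size eval_nat_numeral)
  consider "I \<in> instrs P" | "x = lp" | "x = ex"
    using while.prems by (auto simp: Q P\<^sub>i)
  then show ?case
  proof cases
    case 1
    then show ?thesis using while.IH[OF pl(1) ex] while.prems unfolding Q P\<^sub>i by fastforce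
  next
    case 2
    then show ?thesis using exits_toD[OF pl(2)] while.prems unfolding Q P\<^sub>i by fastforce
  next
    case 3
    then show ?thesis using while.prems by (auto simp: exits_to_def)
  qed
qed (auto dest!: compile_expr_instrs)

section \<open>High regions of code\<close>

lemma nexts_targets:
  assumes "i < length Pr"
  shows "nexts i \<subseteq> {i, Suc i} \<union> {q. \<exists>x\<in>targets (snd (Pr ! i)). labelled_at Pr x q}"
  using assms by (cases "snd (Pr ! i)") (auto simp: nexts_def jumps_def split: if_splits)

lemma nexts_no_targets: "i < length Pr \<Longrightarrow> targets (snd (Pr ! i)) = {} \<Longrightarrow> nexts i = {Suc i}"
  by (cases "snd (Pr ! i)") (auto simp: nexts_def)

text \<open>Coinduction over all positions from \<open>p\<close> to the end: every instruction is
  invisible, \<open>compile_targets\<close> keeps the successors in this range, and the end is high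
  by assumption.\<close>

lemma compile_high:
  assumes "compile v2p vl rl \<Phi> l C P tp l' \<Phi>'" "fst tp = WrH" "placed Pr p P"
    and "exits_to l' (p + length (assemble P))" "high (p + length (assemble P))"
    and "p \<le> i" "i \<le> p + length (assemble P)"
  shows "high i"
proof -
  let ?e = "p + length (assemble P)"
  have "p \<le> i \<and> i \<le> ?e" using assms by simp
  then show ?thesis
  proof (coinduction arbitrary: i rule: high.coinduct)
    case (high i)
    show ?case
    proof (cases "i = ?e")
      case True
      then show ?thesis using assms(5) by (auto elim: high.cases)
    next
      case False
      then have i: "i < length Pr" "snd (Pr ! i) \<in> instrs P"
        using placed_instr[OF assms(3)] high by auto
      have "nexts i \<subseteq> {p..?e}"
        using nexts_targets[OF i(1)] compile_targets[OF assms(1,3,4) i(2)] high False by fastforce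
      then show ?thesis using compile_invisible[OF assms(1,2) i(2)] by auto
    qed
  qed
qed

text \<open>Coinduction with \<open>i\<close> as the only candidate. The self-loop accounts for an
  exit jump whose label resolves to nothing.\<close>

lemma high_step:
  assumes "i < length Pr" "invisible (snd (Pr ! i))" "\<And>j. j \<in> nexts i \<Longrightarrow> j = i \<or> high j"
  shows "high i"
proof -
  have "i = i" ..
  then show ?thesis
    by (coinduction rule: high.coinduct) (use assms in auto)
qed

lemma high_end: "high (length Pr)"
proof -
  have "length Pr = length Pr" ..
  then show ?thesis
    by (coinduction rule: high.coinduct) (auto simp: nexts_def)
qed

section \<open>Exact running times\<close>

lemma lockstep_trans: "lockstep n i j \<Longrightarrow> lockstep m j e \<Longrightarrow> lockstep (n + m) i e"
  by (induction n arbitrary: i) auto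

lemma lockstep_straight:
  "(\<And>i. p \<le> i \<Longrightarrow> i < p + n \<Longrightarrow> i < length Pr \<and> invisible (snd (Pr ! i)) \<and> nexts i = {Suc i}) \<Longrightarrow>
   lockstep n p (p + n)"
proof (induction n arbitrary: p)
  case (Suc n)
  have "lockstep n (Suc p) (Suc p + n)" by (rule Suc.IH) (use Suc.prems in auto)
  then show ?case using Suc.prems[of p] by simp
qed simp

lemma lockstep_code:
  assumes "placed Pr p c" and "\<forall>I\<in>instrs c. invisible I \<and> targets I = {}"
  shows "lockstep (length (assemble c)) p (p + length (assemble c))"
  using placed_instr[OF assms(1)] assms(2) nexts_no_targets by (intro lockstep_straight) blast

text \<open>Skipping the code of the guard turns lockstep of a whole conditional into lockstep at
  its branch instruction.\<close>

lemma lockstep_drop: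
  "(\<And>i. p \<le> i \<Longrightarrow> i < p + n \<Longrightarrow> nexts i = {Suc i}) \<Longrightarrow> lockstep (n + k) p e \<Longrightarrow> lockstep k (p + n) e"
proof (induction n arbitrary: p)
  case (Suc n)
  have "lockstep k (Suc p + n) e" by (rule Suc.IH) (use Suc.prems in auto)
  then show ?case by simp
qed simp

lemma lockstep_nops:
  assumes "placed Pr p (nops n)" shows "lockstep n p (p + n)"
  using lockstep_code[OF assms] instrs_nops[of n] by fastforce

lemma timing_vee_not_Trm [simp]: "t\<^sub>1 \<curlyvee> t\<^sub>2 \<noteq> Trm n"
  by (simp add: timing_vee_def)

lemma timing_plus_Trm:
  "t\<^sub>1 \<uplus>\<^sub>t t\<^sub>2 = Trm n \<Longrightarrow> \<exists>n\<^sub>1 n\<^sub>2. t\<^sub>1 = Trm n\<^sub>1 \<and> t\<^sub>2 = Trm n\<^sub>2 \<and> n = n\<^sub>1 + n\<^sub>2"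
  by (cases "(t\<^sub>1, t\<^sub>2)" rule: timing_plus.cases) auto

text \<open>A timing \<open>Trm n\<close> is given only to code with high effects, so invisibility
  comes along with the count. The exit label has to mark the end, since a jump to an unresolved
  label never arrives.\<close>

lemma compile_lockstep:
  "compile v2p vl rl \<Phi> l C P tp l' \<Phi>' \<Longrightarrow> snd tp = Trm n \<Longrightarrow> placed Pr p P \<Longrightarrow>
   (\<And>x. l' = Some x \<Longrightarrow> labelled_at Pr x (p + length (assemble P))) \<Longrightarrow>
   lockstep n p (p + length (assemble P))"
proof (induction arbitrary: n p rule: compile.induct)
  case (skip \<Phi> l)
  show ?case using lockstep_code[OF skip.prems(2)] skip.prems(1) by auto
next
  case (assign \<Phi> l E P x k r \<Phi>' Q tp)
  then have H: "vl x = H" and n: "n = length (assemble Q)"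
    using compile_expr_instrs[OF assign.hyps(1)] by (auto split: if_splits)
  show ?case
    unfolding n using H assign.hyps(2) compile_expr_instrs[OF assign.hyps(1)]
    by (intro lockstep_code[OF assign.prems(2)]) auto
next
  case (out \<Phi> l E P ch k r \<Phi>' Q tp)
  then have H: "ch = High" and n: "n = length (assemble Q)"
    using compile_expr_instrs[OF out.hyps(1)] by (cases ch; auto split: if_splits)+
  show ?case
    unfolding n using H out.hyps(2) compile_expr_instrs[OF out.hyps(1)]
    by (intro lockstep_code[OF out.prems(2)]) auto
next
  case (if_H \<Phi> l E P\<^sub>0 n\<^sub>0 r \<Phi>\<^sub>1 C\<^sub>1 P\<^sub>1 n\<^sub>1 l\<^sub>1 \<Phi>\<^sub>2 C\<^sub>2 P\<^sub>2 n\<^sub>2 l\<^sub>2 \<Phi>\<^sub>3 m br ex Q)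
  note Q = if_H.hyps(6)
  let ?p\<^sub>0 = "p + length (assemble P\<^sub>0)"
  let ?p\<^sub>1 = "Suc ?p\<^sub>0"
  let ?q\<^sub>1 = "?p\<^sub>1 + length (assemble P\<^sub>1)"
  let ?j = "?q\<^sub>1 + (n\<^sub>2 - n\<^sub>1)"
  let ?p\<^sub>2 = "Suc ?j"
  let ?q\<^sub>2 = "?p\<^sub>2 + length (assemble P\<^sub>2)"
  let ?k = "?q\<^sub>2 + (n\<^sub>1 - n\<^sub>2)"
  have e: "p + length (assemble Q) = Suc ?k" unfolding Q by simp
  note P2 = placed_attach[OF compile_first[OF if_H.hyps(3)]]
  have pl: "placed Pr p P\<^sub>0" "placed Pr ?p\<^sub>1 P\<^sub>1" "placed Pr ?p\<^sub>2 P\<^sub>2" "labelled_at Pr br ?p\<^sub>2"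
    "?p\<^sub>0 < length Pr" "snd (Pr ! ?p\<^sub>0) = Jz br r" "?j < length Pr" "snd (Pr ! ?j) = Jmp ex"
    "?k < length Pr" "snd (Pr ! ?k) = Nop"
    using if_H.prems(2) unfolding Q by (auto simp: P2 add.assoc)
  have pln: "placed Pr ?q\<^sub>1 (nops (n\<^sub>2 - n\<^sub>1))" "placed Pr ?q\<^sub>2 (nops (n\<^sub>1 - n\<^sub>2))"
    using if_H.prems(2) unfolding Q by (auto simp: placed_attach[OF nops_first] add.assoc)
  have ex: "labelled_at Pr x ?q\<^sub>1" if "l\<^sub>1 = Some x" for x
    using if_H.prems(2) that unfolding Q by (auto simp: placed_attach[OF nops_first] add.assoc)
  have ex': "labelled_at Pr x ?q\<^sub>2" if "l\<^sub>2 = Some x" for x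
    using if_H.prems(2) that unfolding Q by (auto simp: placed_attach[OF nops_first] add.assoc)
  have "labelled_at Pr ex (Suc ?k)" using if_H.prems(3) e by simp
  then have "lockstep 1 ?j (Suc ?k)" "lockstep 1 ?k (Suc ?k)"
    using pl by (auto simp: nexts_def jumps_labelled)
  moreover have "lockstep n\<^sub>1 ?p\<^sub>1 ?q\<^sub>1" by (rule if_H.IH(1)[OF _ pl(2) ex]) simp_all
  moreover have "lockstep n\<^sub>2 ?p\<^sub>2 ?q\<^sub>2" by (rule if_H.IH(2)[OF _ pl(3) ex']) simp_all
  ultimately have "lockstep (n\<^sub>1 + ((n\<^sub>2 - n\<^sub>1) + 1)) ?p\<^sub>1 (Suc ?k)"
    "lockstep (n\<^sub>2 + ((n\<^sub>1 - n\<^sub>2) + 1)) ?p\<^sub>2 (Suc ?k)"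
    using lockstep_nops[OF pln(1)] lockstep_nops[OF pln(2)] lockstep_trans by blast+
  \<comment> \<open>Truncated subtraction pads the shorter arm; the additional step is the exit
    \<open>Jmp\<close> of the first arm or the closing \<open>Nop\<close> of the second.\<close>
  moreover have max: "max n\<^sub>1 n\<^sub>2 + 1 = n\<^sub>1 + ((n\<^sub>2 - n\<^sub>1) + 1)" "max n\<^sub>1 n\<^sub>2 + 1 = n\<^sub>2 + ((n\<^sub>1 - n\<^sub>2) + 1)"
    by auto
  ultimately have "lockstep (max n\<^sub>1 n\<^sub>2 + 1) ?p\<^sub>1 (Suc ?k)" "lockstep (max n\<^sub>1 n\<^sub>2 + 1) ?p\<^sub>2 (Suc ?k)"
    by simp_all
  moreover have nxt: "nexts ?p\<^sub>0 = {?p\<^sub>1, ?p\<^sub>2}"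
    using pl by (simp add: nexts_def jumps_labelled)
  ultimately have "lockstep (Suc (max n\<^sub>1 n\<^sub>2 + 1)) ?p\<^sub>0 (Suc ?k)"
    using pl(5,6) by (subst lockstep.simps(2)) (simp del: lockstep.simps add: nxt)
  moreover have "lockstep n\<^sub>0 p ?p\<^sub>0"
    using lockstep_code[OF pl(1)] compile_expr_instrs[OF if_H.hyps(1)] by auto
  ultimately have "lockstep (n\<^sub>0 + Suc (max n\<^sub>1 n\<^sub>2 + 1)) p (Suc ?k)" by (rule lockstep_trans[rotated])
  moreover have "n = n\<^sub>0 + Suc (max n\<^sub>1 n\<^sub>2 + 1)" using if_H.prems(1) if_H.hyps(4) by simp
  ultimately show ?case unfolding e by (simp only:)
next
  case (seq \<Phi> l C\<^sub>1 P\<^sub>1 w\<^sub>1 t\<^sub>1 l\<^sub>1 \<Phi>\<^sub>1 C\<^sub>2 P\<^sub>2 w\<^sub>2 t\<^sub>2 l\<^sub>2 \<Phi>\<^sub>2)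
  obtain n\<^sub>1 n\<^sub>2 where n: "t\<^sub>1 = Trm n\<^sub>1" "t\<^sub>2 = Trm n\<^sub>2" "n = n\<^sub>1 + n\<^sub>2"
    using timing_plus_Trm seq.prems(1) by fastforce
  let ?q = "p + length (assemble P\<^sub>1)"
  have "lockstep n\<^sub>1 p ?q"
    using seq.prems(2) compile_first[OF seq.hyps(2)] n
    by (intro seq.IH) (auto dest: placed_first)
  moreover have "lockstep n\<^sub>2 ?q (?q + length (assemble P\<^sub>2))"
    using seq.prems n by (intro seq.IH) (auto simp: add.assoc)
  ultimately show ?case using lockstep_trans by (simp add: n add.assoc)
qed auto

section \<open>Goodness of every position of compiled code\<close>

definition all_good :: "nat \<Rightarrow> ('w, 'reg, 'lab) code \<Rightarrow> bool" where
  "all_good p c \<longleftrightarrow> (\<forall>i. p \<le> i \<and> i < p + length (assemble c) \<longrightarrow> good i)"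

lemma all_good_append [simp]:
  "all_good p (c @ d) \<longleftrightarrow> all_good p c \<and> all_good (p + length (assemble c)) d"
proof -
  have "i < p + length (assemble c) \<or> p + length (assemble c) \<le> i" for i by linarith
  then show ?thesis unfolding all_good_def by (auto simp: add.assoc)
qed

lemma all_good_Nil [simp]: "all_good p []"
  by (auto simp: all_good_def)

lemma all_good_Cons [simp]: "all_good p ((l, Some I) # c) \<longleftrightarrow> good p \<and> all_good (Suc p) c"
  using all_good_append[of p "[(l, Some I)]" c] by (auto simp: all_good_def less_Suc_eq)

lemma all_good_attach [simp]: "all_good p (attach l c) \<longleftrightarrow> all_good p c"
  by (simp add: all_good_def)

lemma all_good_noninterfering:
  "placed Pr p c \<Longrightarrow> (\<And>I. I \<in> instrs c \<Longrightarrow> noninterfering I) \<Longrightarrow> all_good p c"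
  unfolding all_good_def good_def using placed_instr by blast

lemma good_noninterfering: "snd (Pr ! p) = I \<Longrightarrow> noninterfering I \<Longrightarrow> good p"
  by (auto simp: good_def)

lemma compile_good_high:
  assumes "compile v2p vl rl \<Phi> l C P tp l' \<Phi>'" "fst tp = WrH" "placed Pr p P"
    and "exits_to l' (p + length (assemble P))" "high (p + length (assemble P))"
  shows "all_good p P"
  unfolding all_good_def using compile_high[OF assms] high_good less_imp_le by blast

text \<open>The end must be high in two situations: the exit label is unresolved, so one arm of a
  conditional can get stuck while the other reaches the end, or the timing \<open>TrmH\<close>
  allows runs to lose step with each other.\<close>

lemma compile_good:
  "compile v2p vl rl \<Phi> l C P tp l' \<Phi>' \<Longrightarrow> placed Pr p P \<Longrightarrow>
   exits_to l' (p + length (assemble P)) \<Longrightarrow>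
   (\<And>x. l' = Some x \<Longrightarrow> \<nexists>q. labelled_at Pr x q \<Longrightarrow> high (p + length (assemble P))) \<Longrightarrow>
   (snd tp = TrmH \<Longrightarrow> high (p + length (assemble P))) \<Longrightarrow>
   all_good p P"
proof (induction arbitrary: p rule: compile.induct)
  case (skip \<Phi> l)
  then show ?case by (intro all_good_noninterfering) auto
next
  case (assign \<Phi> l E P x n r \<Phi>' Q tp)
  then show ?case
    using compile_expr_instrs[OF assign.hyps(1)] by (intro all_good_noninterfering) auto
next
  case (out \<Phi> l E P ch n r \<Phi>' Q tp)
  then show ?case
    using compile_expr_instrs[OF out.hyps(1)] by (intro all_good_noninterfering) auto
next
  case (if_any \<Phi> l E P\<^sub>0 lam n\<^sub>0 r \<Phi>\<^sub>1 C\<^sub>1 P\<^sub>1 w\<^sub>1 t\<^sub>1 l\<^sub>1 \<Phi>\<^sub>2 C\<^sub>2 P\<^sub>2 w\<^sub>2 t\<^sub>2 l\<^sub>2 \<Phi>\<^sub>3 br ex Q)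
  show ?case
  \<comment> \<open>A high guard gives timing \<open>TrmH\<close>, so the end and with it the whole
    block are high. A low guard makes the branch noninterfering.\<close>
  proof (cases lam)
    case H
    have "high (p + length (assemble Q))"
      using if_any.prems(4) H by (simp add: timing_vee_def)
    then show ?thesis
      using compile_good_high[OF compile.if_any[OF if_any.hyps]] if_any.prems H by simp
  next
    case L
    note Q = if_any.hyps(7)
    let ?p\<^sub>0 = "p + length (assemble P\<^sub>0)"
    let ?p\<^sub>1 = "Suc ?p\<^sub>0"
    let ?q\<^sub>1 = "?p\<^sub>1 + length (assemble P\<^sub>1)"
    let ?p\<^sub>2 = "Suc ?q\<^sub>1"
    let ?q\<^sub>2 = "?p\<^sub>2 + length (assemble P\<^sub>2)"
    have e: "p + length (assemble Q) = Suc ?q\<^sub>2" unfolding Q by simp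
    note P2 = placed_attach[OF compile_first[OF if_any.hyps(4)]]
    have pl: "placed Pr p P\<^sub>0" "placed Pr ?p\<^sub>1 P\<^sub>1" "placed Pr ?p\<^sub>2 P\<^sub>2"
      "?p\<^sub>0 < length Pr" "snd (Pr ! ?p\<^sub>0) = Jz br r" "?q\<^sub>1 < length Pr" "snd (Pr ! ?q\<^sub>1) = Jmp ex"
      "?q\<^sub>2 < length Pr" "snd (Pr ! ?q\<^sub>2) = Nop"
      "\<And>x. l\<^sub>1 = Some x \<Longrightarrow> labelled_at Pr x ?q\<^sub>1" "\<And>x. l\<^sub>2 = Some x \<Longrightarrow> labelled_at Pr x ?q\<^sub>2"
      using if_any.prems(1) unfolding Q by (auto simp: P2 add.assoc)
    \<comment> \<open>An arm ends at the exit \<open>Jmp\<close> or the closing \<open>Nop\<close>.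
      Both lead to the end of the conditional, unless the jump is stuck on itself, which is high
      too.\<close>
    have high: "high ?q\<^sub>1" "high ?q\<^sub>2" if "t\<^sub>1 = TrmH \<or> t\<^sub>2 = TrmH"
    proof -
      have "high (Suc ?q\<^sub>2)"
        using that if_any.prems(4) L e by (auto simp: timing_vee_def)
      moreover have "nexts ?q\<^sub>1 \<subseteq> {?q\<^sub>1, Suc ?q\<^sub>2}" "nexts ?q\<^sub>2 = {Suc ?q\<^sub>2}"
        using pl if_any.prems(2) e by (auto simp: nexts_def jumps_def exits_to_def split: if_splits)
      ultimately show "high ?q\<^sub>1" "high ?q\<^sub>2"
        using pl high_step[of ?q\<^sub>1] high_step[of ?q\<^sub>2] by auto
    qed
    have "all_good ?p\<^sub>1 P\<^sub>1"
      using pl high by (intro if_any.IH(1) exits_toI) auto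
    moreover have "all_good ?p\<^sub>2 P\<^sub>2"
      using pl high by (intro if_any.IH(2) exits_toI) auto
    moreover have "all_good p P\<^sub>0" "good ?p\<^sub>0" "good ?q\<^sub>1" "good ?q\<^sub>2"
      using pl compile_expr_instrs[OF if_any.hyps(1)] L
      by (auto intro: all_good_noninterfering good_noninterfering)
    ultimately show ?thesis unfolding Q by (simp add: add.assoc)
  qed
next
  case (if_H \<Phi> l E P\<^sub>0 n\<^sub>0 r \<Phi>\<^sub>1 C\<^sub>1 P\<^sub>1 n\<^sub>1 l\<^sub>1 \<Phi>\<^sub>2 C\<^sub>2 P\<^sub>2 n\<^sub>2 l\<^sub>2 \<Phi>\<^sub>3 m br ex Q)
  show ?case
  \<comment> \<open>If \<open>ex\<close> is unresolved, the first arm is stuck at its jump and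
    lockstep fails, but then the end is high by assumption and so is the whole block.\<close>
  proof (cases "\<exists>q. labelled_at Pr ex q")
    case False
    then show ?thesis
      using compile_good_high[OF compile.if_H[OF if_H.hyps]] if_H.prems by simp
  next
    case True
    note Q = if_H.hyps(6)
    let ?p\<^sub>0 = "p + length (assemble P\<^sub>0)"
    let ?p\<^sub>1 = "Suc ?p\<^sub>0"
    let ?q\<^sub>1 = "?p\<^sub>1 + length (assemble P\<^sub>1)"
    let ?j = "?q\<^sub>1 + (n\<^sub>2 - n\<^sub>1)"
    let ?p\<^sub>2 = "Suc ?j"
    let ?q\<^sub>2 = "?p\<^sub>2 + length (assemble P\<^sub>2)"
    let ?k = "?q\<^sub>2 + (n\<^sub>1 - n\<^sub>2)"
    have e: "p + length (assemble Q) = Suc ?k" unfolding Q by simp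
    have ex: "labelled_at Pr ex (p + length (assemble Q))"
      using True if_H.prems(2) by (auto simp: exits_to_def)
    note P2 = placed_attach[OF compile_first[OF if_H.hyps(3)]]
    have pl: "placed Pr p P\<^sub>0" "placed Pr ?p\<^sub>1 P\<^sub>1" "placed Pr ?p\<^sub>2 P\<^sub>2"
      "snd (Pr ! ?j) = Jmp ex" "snd (Pr ! ?k) = Nop"
      using if_H.prems(1) unfolding Q by (auto simp: P2 add.assoc)
    have pln: "placed Pr ?q\<^sub>1 (nops (n\<^sub>2 - n\<^sub>1))" "placed Pr ?q\<^sub>2 (nops (n\<^sub>1 - n\<^sub>2))"
      "\<And>x. l\<^sub>1 = Some x \<Longrightarrow> labelled_at Pr x ?q\<^sub>1" "\<And>x. l\<^sub>2 = Some x \<Longrightarrow> labelled_at Pr x ?q\<^sub>2"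
      using if_H.prems(1) unfolding Q by (auto simp: placed_attach[OF nops_first] add.assoc)
    have "all_good ?p\<^sub>1 P\<^sub>1" "all_good ?p\<^sub>2 P\<^sub>2"
      using pl pln by (intro if_H.IH exits_toI; auto)+
    moreover have "all_good ?q\<^sub>1 (nops (n\<^sub>2 - n\<^sub>1))" "all_good ?q\<^sub>2 (nops (n\<^sub>1 - n\<^sub>2))"
      using pln instrs_nops by (fastforce intro!: all_good_noninterfering)+
    moreover have "all_good p P\<^sub>0" "good ?j" "good ?k"
      using pl compile_expr_instrs[OF if_H.hyps(1)]
      by (auto intro: all_good_noninterfering good_noninterfering)
    \<comment> \<open>Lockstep of the whole conditional is cut down to the branch; \<open>m\<close>
      is split into the guard code and a successor, since \<open>lockstep_good\<close> asks for at
      least one remaining step.\<close>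
    moreover have "good ?p\<^sub>0"
    proof -
      have "lockstep m p (p + length (assemble Q))"
        using if_H.prems(1) ex by (intro compile_lockstep[OF compile.if_H[OF if_H.hyps]]) auto
      moreover have "m = length (assemble P\<^sub>0) + Suc (max n\<^sub>1 n\<^sub>2 + 1)"
        using if_H.hyps(4) compile_expr_instrs[OF if_H.hyps(1)] by simp
      moreover have "nexts i = {Suc i}" if "p \<le> i" "i < ?p\<^sub>0" for i
        using placed_instr[OF pl(1) that] compile_expr_instrs[OF if_H.hyps(1)]
        by (intro nexts_no_targets) auto
      ultimately show ?thesis
        using lockstep_drop[of p "length (assemble P\<^sub>0)"] lockstep_good by blast
    qed
    ultimately show ?thesis unfolding Q by (simp add: add.assoc)
  qed
next
  case (seq \<Phi> l C\<^sub>1 P\<^sub>1 w\<^sub>1 t\<^sub>1 l\<^sub>1 \<Phi>\<^sub>1 C\<^sub>2 P\<^sub>2 w\<^sub>2 t\<^sub>2 l\<^sub>2 \<Phi>\<^sub>2)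
  let ?q = "p + length (assemble P\<^sub>1)"
  have pl: "placed Pr p P\<^sub>1" "placed Pr ?q P\<^sub>2" using seq.prems(1) by auto
  have l\<^sub>1: "labelled_at Pr x ?q" if "l\<^sub>1 = Some x" for x
    using pl that compile_first[OF seq.hyps(2)] by (auto dest: placed_first)
  have end_high: "high (?q + length (assemble P\<^sub>2))" if "t\<^sub>1 = TrmH \<or> t\<^sub>2 = TrmH"
    using that seq.prems(4)
    by (cases "(t\<^sub>1, t\<^sub>2)" rule: timing_plus.cases) (auto simp: timing_vee_def add.assoc)
  have exits: "exits_to l\<^sub>2 (?q + length (assemble P\<^sub>2))"
    using seq.prems(2) by (simp add: add.assoc)
  \<comment> \<open>After a first command with timing \<open>TrmH\<close> the second is
    \<open>WrH\<close>. The sum of the timings is \<open>TrmH\<close> too, so the end is high, and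
    \<open>compile_high\<close> carries this back to the start of \<open>P\<^sub>2\<close>.\<close>
  have "high ?q" if "t\<^sub>1 = TrmH"
    using that compile_high[OF seq.hyps(2) _ pl(2) exits] end_high seq.hyps(3) by simp
  then have "all_good p P\<^sub>1"
    using pl l\<^sub>1 by (intro seq.IH(1) exits_toI) auto
  moreover have "all_good ?q P\<^sub>2"
    using pl exits end_high seq.prems(3) by (intro seq.IH(2)) (auto simp: add.assoc)
  ultimately show ?case by simp
next
  case (while lam x r \<Phi>\<^sub>B \<Phi> \<Phi>\<^sub>E C P w t l' P\<^sub>i l lp ex Q)
  show ?case
  proof (cases lam)
    case H
    have "high (p + length (assemble Q))"
      using while.prems(4) H by (simp add: timing_vee_def)
    then show ?thesis
      using compile_good_high[OF compile.while[OF while.hyps]] while.prems H by simp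
  next
    case L
    note Q = while.hyps(10) and P\<^sub>i = while.hyps(8)
    let ?p\<^sub>1 = "p + 3"
    let ?q = "?p\<^sub>1 + length (assemble P)"
    have first: "\<exists>b d. P\<^sub>i = (None, b) # d" by (simp add: P\<^sub>i)
    have size: "length (assemble P\<^sub>i) = 2" by (simp add: P\<^sub>i)
    have pl: "placed Pr p P\<^sub>i" "snd (Pr ! (p + 2)) = Jz ex r" "placed Pr ?p\<^sub>1 P" "placed Pr ?q P\<^sub>i"
      "snd (Pr ! (?q + 2)) = Jmp lp" "\<And>x. l' = Some x \<Longrightarrow> labelled_at Pr x ?q"
      using while.prems(1) by (auto simp: Q placed_attach[OF first] size eval_nat_numeral)
    \<comment> \<open>Under a low guard, a body with timing \<open>TrmH\<close> would require
      \<open>write_of L = WrH\<close>. Hence the induction hypothesis does not ask for a high end of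
      the body.\<close>
    have "t \<noteq> TrmH" using while.hyps(7) L by auto
    then have "all_good ?p\<^sub>1 P"
      using pl by (intro while.IH exits_toI) auto
    moreover have "noninterfering I" if "I \<in> instrs P\<^sub>i" for I
      using that while.hyps(1,2) by (auto simp: P\<^sub>i)
    then have "all_good p P\<^sub>i" "all_good ?q P\<^sub>i"
      using pl by (auto intro: all_good_noninterfering)
    moreover have "good (p + 2)" "good (?q + 2)"
      using pl while.hyps(2) L by (auto intro: good_noninterfering)
    ultimately show ?thesis by (simp add: Q size eval_nat_numeral)
  qed
qed

end

theorem theorem3:
  fixes v2p :: "'var \<Rightarrow> 'w::semiring_1"
    and vl :: "'var \<Rightarrow> level"
    and rl :: "'reg \<Rightarrow> level"
    and C :: "('w, 'var) com"
    and P :: "('w, 'reg, 'lab) code"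
    and w :: write_effect and t :: timing
    and l :: "'lab option"
    and \<Phi> :: "'reg \<rightharpoonup> 'var"
  assumes "inj v2p"
    and "fits (assemble P)"
    and "compile v2p vl rl Map.empty None C P (w, t) l \<Phi>"
  shows "strongly_secure v2p vl rl (assemble P)"
proof -
  have unclashed: "unclashed False P" "\<not> pending False P"
    using compile_unclashed[OF assms(3), of False] by auto
  have "placed ([] @ attach None (assemble P)) (length []) P"
    using placed_assemble[OF unclashed, where l = None and pre = "[]"] by simp
  then have placed: "placed (assemble P) 0 P" by simp
  have labels: "List.map_filter fst (assemble P) = List.map_filter fst P"
    using map_filter_fst_assemble[OF unclashed] by blast
  interpret machine "assemble P" v2p vl rl
    using assms labels compile_distinct_labels[OF assms(3)]
    by unfold_locales (auto simp: distinct_labels_def)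
  have "\<not> labelled_at (assemble P) x q" if "l = Some x" for x q
  proof
    assume "labelled_at (assemble P) x q"
    then have "x \<in> set (List.map_filter fst (assemble P))" by (rule labelled_at_in_labels)
    then show False
      using compile_exit_label[OF assms(3) that] labels by (simp add: code_labels_def)
  qed
  \<comment> \<open>The code ends at \<open>length (assemble P)\<close>, which is high by
    \<open>high_end\<close>, and \<open>exits_to\<close> holds vacuously.\<close>
  then have "all_good 0 P"
    using compile_good[OF assms(3) placed] high_end by (auto simp: exits_to_def)
  then have "strong_bisimulation v2p vl rl
    {((assemble P, of_nat i), (assemble P, of_nat j)) | i j.
      i \<le> length (assemble P) \<and> j \<le> length (assemble P) \<and> synced i j}"
    by (intro bisimulation) (simp add: all_good_def)
  moreover have "((assemble P, 0), (assemble P, 0)) \<in>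
    {((assemble P, of_nat i), (assemble P, of_nat j)) | i j.
      i \<le> length (assemble P) \<and> j \<le> length (assemble P) \<and> synced i j}"
    using synced_refl[of 0] by (auto intro!: exI[of _ 0])
  ultimately show ?thesis unfolding strongly_secure_def by blast
qed

end
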